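(* Let $\Omega\subset\mathbb{C}$ be a domain, let $u_0,\dots,u_N:\Omega\to\mathbb{R}$ be a smooth solution of the periodic 2D-Toda lattice, let $|\lambda|=1$ be fixed, and suppose that for some $m\ge1$ the $m$-th flow of the hierarchy is trivial, so that $\partial L_m=[L_m,A_\lambda]$ and $\overline{\partial}L_m=[L_m,B_\lambda]$. Put $K=[L_m+L_m^{\dagger},B_\lambda]$. Then $K^{\dagger}=[L_m+L_m^{\dagger},A_\lambda]$ and the conservation law $$\partial K-\overline{\partial}K^{\dagger}=0$$ holds. Consequently the matrix-valued $1$-form $i(K^{\dagger}\,d\xi+K\,d\overline{\xi})$ is closed and takes values in $\mathfrak{su}(N+1)$, the integral $$X(\xi,\overline{\xi})=i\int_\gamma\left(K^{\dagger}\,d\xi+K\,d\overline{\xi}\right)$$ depends locally only on the end points of the curve $\gamma$ in $\Omega$, and it defines (locally) a mapping $X$ into $\mathfrak{su}(N+1)\cong\mathbb{R}^{(N+1)^2-1}$ whose complex tangent vectors are $\partial X=iK^{\dagger}$ and $\overline{\partial}X=iK$.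
   Context: Notation: $\partial=\partial_\xi$, $\overline{\partial}=\partial_{\overline{\xi}}$, $\xi\in\Omega$; $\dagger$ is the Hermitian conjugate. Matrices are $(N+1)\times(N+1)$, with rows and columns indexed by $0,\dots,N$. $\mathfrak{su}(N+1)$ is the space of traceless anti-Hermitian matrices. For real-valued functions $u_0,\dots,u_N$ with $\sum_i u_i=0$ put $U_{i,j}=e^{u_i-u_j}$. For $\lambda\in\mathbb{C}\setminus\{0\}$ let $A_\lambda$ be the matrix with diagonal entries $\partial u_0,\dots,\partial u_N$, subdiagonal entries $(A_\lambda)_{j,j-1}=U_{j,j-1}$ ($j=1,\dots,N$), upper right corner entry $(A_\lambda)_{0,N}=\lambda U_{0,N}$, and all other entries $0$. Let $\rho(\sum_i X_i\lambda^i)=\sum_i X_i^{\dagger}\lambda^{-i}$ and $B_\lambda=-\rho(A_\lambda)$; for $|\lambda|=1$ this means $B_\lambda=-A_\lambda^{\dagger}$. The periodic 2D-Toda lattice is the equation $\overline{\partial}A_\lambda-\partial B_\lambda=[A_\lambda,B_\lambda]$. Let $\Lambda$ be the matrix with $1$'s on the subdiagonal, $\lambda$ in the upper right corner, and zeros elsewhere. The dressing matrix $T_\infty=D_0+D_1\Lambda^{-1}+D_2\Lambda^{-2}+\cdots$ ($D_i$ diagonal, $D_0$ invertible) is a formal series with $T_\infty(\partial+\Lambda)T_\infty^{-1}=\partial+A_\lambda$ and $\overline{\partial}T_\infty=-B_\lambda T_\infty$. Set $L_m=(T_\infty\Lambda^mT_\infty^{-1})_+$, where $(\cdot)_+$ is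 the part polynomial in $\Lambda$ (with diagonal coefficients). The $m$-th flow is $\partial_{t_m}A_\lambda-\partial L_m=[A_\lambda,L_m]$, $\partial_{t_m}B_\lambda-\overline{\partial}L_m=[B_\lambda,L_m]$; it is trivial when $\partial_{t_m}A_\lambda=\partial_{t_m}B_\lambda=0$. *)

theory Defs
  imports "HOL-Analysis.Analysis"
begin

section \<open>Smooth functions and Wirtinger derivatives\<close>

primrec C_on :: "nat \<Rightarrow> complex set \<Rightarrow> (complex \<Rightarrow> 'b::real_normed_vector) \<Rightarrow> bool" where
  "C_on 0 S f \<longleftrightarrow> continuous_on S f"
| "C_on (Suc k) S f \<longleftrightarrow> (\<forall>z\<in>S. f differentiable (at z)) \<and>
     (\<forall>v. C_on k S (\<lambda>z. frechet_derivative f (at z) v))"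

text \<open>Real \<open>C\<^sup>\<infinity>\<close>-smoothness; meant for open \<open>S\<close>.\<close>

definition smooth_on :: "complex set \<Rightarrow> (complex \<Rightarrow> 'b::real_normed_vector) \<Rightarrow> bool" where
  "smooth_on S f \<longleftrightarrow> (\<forall>k. C_on k S f)"

definition dz :: "(complex \<Rightarrow> complex) \<Rightarrow> complex \<Rightarrow> complex" where
  "dz f z = (frechet_derivative f (at z) 1 - \<i> * frechet_derivative f (at z) \<i>) / 2"

definition dzbar :: "(complex \<Rightarrow> complex) \<Rightarrow> complex \<Rightarrow> complex" where
  "dzbar f z = (frechet_derivative f (at z) 1 + \<i> * frechet_derivative f (at z) \<i>) / 2"


section \<open>Matrices\<close>

text \<open>The matrix product is \<open>**\<close>; the overloaded \<open>*\<close> on \<open>complex^'n^'n\<close> would be the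
  entrywise product.\<close>

type_synonym 'n cmat = "complex^'n^'n"

definition mat_dz :: "(complex \<Rightarrow> 'n::finite cmat) \<Rightarrow> complex \<Rightarrow> 'n cmat" where
  "mat_dz M z = (\<chi> i j. dz (\<lambda>w. M w $ i $ j) z)"

definition mat_dzbar :: "(complex \<Rightarrow> 'n::finite cmat) \<Rightarrow> complex \<Rightarrow> 'n cmat" where
  "mat_dzbar M z = (\<chi> i j. dzbar (\<lambda>w. M w $ i $ j) z)"

definition cscale :: "complex \<Rightarrow> 'n::finite cmat \<Rightarrow> 'n cmat" (infixr \<open>*\<^sub>c\<close> 75) where
  "c *\<^sub>c M = (\<chi> i j. c * M $ i $ j)"

definition hconj :: "'n::finite cmat \<Rightarrow> 'n cmat" (\<open>_\<^sup>\<dagger>\<close> [1000] 999) where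
  "M\<^sup>\<dagger> = (\<chi> i j. cnj (M $ j $ i))"

definition comm :: "'n::finite cmat \<Rightarrow> 'n cmat \<Rightarrow> 'n cmat" where
  "comm X Y = X ** Y - Y ** X"

definition diag :: "complex^'n::finite \<Rightarrow> 'n cmat" where
  "diag d = (\<chi> i j. if i = j then d $ i else 0)"

definition su :: "'n::finite cmat set" where
  "su = {M. M\<^sup>\<dagger> = - M \<and> trace M = 0}"

definition mat_pow :: "'n::finite cmat \<Rightarrow> int \<Rightarrow> 'n cmat" where
  "mat_pow M k = (if k \<ge> 0 then (((**) M) ^^ nat k) (mat 1)
                  else (((**) (matrix_inv M)) ^^ nat (- k)) (mat 1))"


section \<open>Row numbers\<close>

text \<open>The index type is any finite linear order with \<open>N + 1\<close> elements; \<open>pos\<close> is its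
  increasing enumeration by \<open>0, \<dots>, N\<close>. The inverse \<open>ix\<close> reads row numbers modulo \<open>N + 1\<close>.\<close>

definition pos :: "'n::{finite,linorder} \<Rightarrow> nat" where
  "pos i = card {k. k < i}"

definition ix :: "int \<Rightarrow> 'n::{finite,linorder}" where
  "ix k = (THE i. int (pos i) = k mod int CARD('n))"


section \<open>The periodic 2D-Toda lattice\<close>

type_synonym 'n field_tuple = "'n \<Rightarrow> complex \<Rightarrow> real"

definition U :: "'n field_tuple \<Rightarrow> complex \<Rightarrow> 'n \<Rightarrow> 'n \<Rightarrow> complex" where
  "U u z i j = of_real (exp (u i z - u j z))"

definition du :: "'n field_tuple \<Rightarrow> complex \<Rightarrow> 'n \<Rightarrow> complex" where
  "du u z i = dz (\<lambda>w. of_real (u i w)) z"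

definition toda_A :: "complex \<Rightarrow> 'n::{finite,linorder} field_tuple \<Rightarrow> complex \<Rightarrow> 'n cmat" where
  "toda_A lam u z = (\<chi> i j.
     if i = j then du u z i
     else if pos i = pos j + 1 then U u z i j
     else if pos i = 0 \<and> pos j + 1 = CARD('n) then lam * U u z i j
     else 0)"

text \<open>Laurent polynomials \<open>\<Sum>\<^sub>p X\<^sub>p \<lambda>\<^sup>p\<close> with matrix coefficients, given by \<open>p \<mapsto> X\<^sub>p\<close>
  (finite support), and the operation \<open>\<rho>\<close> on them.\<close>

definition lp_eval :: "(int \<Rightarrow> 'n::finite cmat) \<Rightarrow> complex \<Rightarrow> 'n cmat" where
  "lp_eval X lam = (\<Sum>p | X p \<noteq> 0. (lam powi p) *\<^sub>c X p)"

definition rho :: "(int \<Rightarrow> 'n::finite cmat) \<Rightarrow> int \<Rightarrow> 'n cmat" where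
  "rho X p = (X (- p))\<^sup>\<dagger>"

definition toda_A_coeffs :: "'n::{finite,linorder} field_tuple \<Rightarrow> complex \<Rightarrow> int \<Rightarrow> 'n cmat" where
  "toda_A_coeffs u z p =
     (if p = 0 then (\<chi> i j. if i = j then du u z i else if pos i = pos j + 1 then U u z i j else 0)
      else if p = 1 then (\<chi> i j. if pos i = 0 \<and> pos j + 1 = CARD('n) then U u z i j else 0)
      else 0)"

definition toda_B :: "complex \<Rightarrow> 'n::{finite,linorder} field_tuple \<Rightarrow> complex \<Rightarrow> 'n cmat" where
  "toda_B lam u z = - lp_eval (rho (toda_A_coeffs u z)) lam"

definition toda_lattice :: "complex set \<Rightarrow> 'n::{finite,linorder} field_tuple \<Rightarrow> bool" where
  "toda_lattice \<Omega> u \<longleftrightarrow> (\<forall>lam. lam \<noteq> 0 \<longrightarrow> (\<forall>z\<in>\<Omega>.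
     mat_dzbar (toda_A lam u) z - mat_dz (toda_B lam u) z = comm (toda_A lam u z) (toda_B lam u z)))"


section \<open>Formal series in \<open>\<Lambda>\<close> with diagonal coefficients\<close>

definition Lam :: "complex \<Rightarrow> 'n::{finite,linorder} cmat" where
  "Lam lam = (\<chi> i j. if pos i = pos j + 1 then 1
                     else if pos i = 0 \<and> pos j + 1 = CARD('n) then lam else 0)"

text \<open>A formal series \<open>\<Sum>\<^sub>k a\<^sub>k \<Lambda>\<^sup>k\<close> whose exponents are bounded above is the function
  \<open>k \<mapsto> a\<^sub>k\<close>, the diagonal matrix \<open>a\<^sub>k\<close> being given by its diagonal; products of diagonals are
  entrywise. Multiplication is determined by \<open>\<Lambda>\<^sup>k d = (shift k d) \<Lambda>\<^sup>k\<close> for diagonal \<open>d\<close>. The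
  spectral parameter is \<open>\<Lambda>\<close> to the power \<open>N + 1\<close> and does not occur in the coefficients.\<close>

type_synonym 'n lser = "int \<Rightarrow> complex^'n"

definition bdd_ser :: "'n::finite lser \<Rightarrow> bool" where
  "bdd_ser a \<longleftrightarrow> (\<exists>K. \<forall>k>K. a k = 0)"

definition shift :: "int \<Rightarrow> complex^'n::{finite,linorder} \<Rightarrow> complex^'n::{finite,linorder}" where
  "shift k d = (\<chi> i. d $ ix (int (pos i) - k))"

text \<open>If both factors have exponents bounded above, the index set of the sum is finite.\<close>

definition lmul :: "'n::{finite,linorder} lser \<Rightarrow> 'n lser \<Rightarrow> 'n lser" where
  "lmul a b = (\<lambda>k. \<Sum>i | a i \<noteq> 0 \<and> b (k - i) \<noteq> 0. a i * shift i (b (k - i)))"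

definition Lam_ser :: "nat \<Rightarrow> 'n::finite lser"  \<comment> \<open>\<open>\<Lambda>\<^sup>m\<close>\<close> where
  "Lam_ser m = (\<lambda>k. if k = int m then 1 else 0)"

definition linv :: "'n::{finite,linorder} lser \<Rightarrow> 'n lser" where
  "linv a = (THE b. bdd_ser b \<and> lmul a b = Lam_ser 0 \<and> lmul b a = Lam_ser 0)"

definition lplus :: "'n::finite lser \<Rightarrow> 'n lser" where
  "lplus a = (\<lambda>k. if k \<ge> 0 then a k else 0)"

text \<open>The matrix \<open>\<Sum>\<^sub>k a\<^sub>k \<Lambda>\<^sup>k\<close> of a series with finitely many terms, at a value of the
  spectral parameter.\<close>

definition lev :: "complex \<Rightarrow> 'n::{finite,linorder} lser \<Rightarrow> 'n cmat" where
  "lev lam a = (\<Sum>k | a k \<noteq> 0. diag (a k) ** mat_pow (Lam lam) k)"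

definition lser_dz :: "(complex \<Rightarrow> 'n::finite lser) \<Rightarrow> complex \<Rightarrow> 'n lser" where
  "lser_dz F z = (\<lambda>k. \<chi> i. dz (\<lambda>w. F w k $ i) z)"

definition lser_dzbar :: "(complex \<Rightarrow> 'n::finite lser) \<Rightarrow> complex \<Rightarrow> 'n lser" where
  "lser_dzbar F z = (\<lambda>k. \<chi> i. dzbar (\<lambda>w. F w k $ i) z)"

text \<open>\<open>A\<^sub>\<lambda>\<close> and \<open>B\<^sub>\<lambda>\<close> as series in \<open>\<Lambda>\<close>; see \<open>lev_A_ser\<close> and \<open>lev_B_ser\<close> below.\<close>

definition A_ser :: "'n::{finite,linorder} field_tuple \<Rightarrow> complex \<Rightarrow> 'n lser" where
  "A_ser u z k = (if k = 0 then (\<chi> i. du u z i)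
                  else if k = 1 then (\<chi> i. U u z i (ix (int (pos i) - 1)))
                  else 0)"

definition B_ser :: "'n::{finite,linorder} field_tuple \<Rightarrow> complex \<Rightarrow> 'n lser" where
  "B_ser u z k = (if k = 0 then (\<chi> i. - cnj (du u z i))
                  else if k = - 1 then (\<chi> i. - U u z (ix (int (pos i) + 1)) i)
                  else 0)"


section \<open>Dressing matrix and flows\<close>

text \<open>The identity \<open>T (\<partial> + \<Lambda>) T\<^sup>-\<^sup>1 = \<partial> + A\<close> is one between differential operators; it is stated
  by applying both sides to every smooth series-valued function \<open>F\<close>.\<close>

definition conn :: "(complex \<Rightarrow> 'n::{finite,linorder} lser) \<Rightarrow> (complex \<Rightarrow> 'n lser)
    \<Rightarrow> complex \<Rightarrow> 'n lser"  \<comment> \<open>\<open>(\<partial> + a) F\<close>\<close> where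
  "conn a F z = (\<lambda>k. lser_dz F z k + lmul (a z) (F z) k)"

definition smooth_lser_on :: "complex set \<Rightarrow> (complex \<Rightarrow> 'n::finite lser) \<Rightarrow> bool" where
  "smooth_lser_on \<Omega> F \<longleftrightarrow> (\<exists>K. \<forall>z\<in>\<Omega>. \<forall>k>K. F z k = 0) \<and> (\<forall>k. smooth_on \<Omega> (\<lambda>z. F z k))"

definition dressing ::
    "complex set \<Rightarrow> 'n::{finite,linorder} field_tuple \<Rightarrow> (complex \<Rightarrow> 'n lser) \<Rightarrow> bool" where
  "dressing \<Omega> u T \<longleftrightarrow>
     smooth_lser_on \<Omega> T \<and>
     (\<forall>z\<in>\<Omega>. (\<forall>k>0. T z k = 0) \<and> (\<forall>i. T z 0 $ i \<noteq> 0)) \<and>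
     (\<forall>F. smooth_lser_on \<Omega> F \<longrightarrow> (\<forall>z\<in>\<Omega>.
        lmul (T z) (conn (\<lambda>_. Lam_ser 1) (\<lambda>w. lmul (linv (T w)) (F w)) z)
        = conn (A_ser u) F z)) \<and>
     (\<forall>z\<in>\<Omega>. lser_dzbar T z = (\<lambda>k. - lmul (B_ser u z) (T z) k))"

definition flow_L ::
    "complex \<Rightarrow> nat \<Rightarrow> (complex \<Rightarrow> 'n::{finite,linorder} lser) \<Rightarrow> complex \<Rightarrow> 'n cmat" where
  "flow_L lam m T z = lev lam (lplus (lmul (lmul (T z) (Lam_ser m)) (linv (T z))))"

text \<open>The equations of the \<open>m\<close>-th flow; \<open>dA\<close> and \<open>dB\<close> stand for the derivatives of \<open>A\<^sub>\<lambda>\<close> and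
  \<open>B\<^sub>\<lambda>\<close> with respect to \<open>t\<^sub>m\<close>.\<close>

definition flow_eqs ::
    "complex set \<Rightarrow> complex \<Rightarrow> nat \<Rightarrow> 'n::{finite,linorder} field_tuple \<Rightarrow> (complex \<Rightarrow> 'n lser)
     \<Rightarrow> (complex \<Rightarrow> 'n cmat) \<Rightarrow> (complex \<Rightarrow> 'n cmat) \<Rightarrow> bool" where
  "flow_eqs \<Omega> lam m u T dA dB \<longleftrightarrow> (\<forall>z\<in>\<Omega>.
     dA z - mat_dz (flow_L lam m T) z = comm (toda_A lam u z) (flow_L lam m T z) \<and>
     dB z - mat_dzbar (flow_L lam m T) z = comm (toda_B lam u z) (flow_L lam m T z))"

definition flow_trivial ::
    "complex set \<Rightarrow> complex \<Rightarrow> nat \<Rightarrow> 'n::{finite,linorder} field_tuple \<Rightarrow> (complex \<Rightarrow> 'n lser)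
     \<Rightarrow> bool" where
  "flow_trivial \<Omega> lam m u T \<longleftrightarrow> flow_eqs \<Omega> lam m u T (\<lambda>_. 0) (\<lambda>_. 0)"


section \<open>Matrix-valued 1-forms\<close>

text \<open>A 1-form \<open>\<omega>\<close> sends a point \<open>z\<close> and a tangent vector \<open>v\<close> to a matrix; \<open>d\<xi>\<close> and its conjugate
  are \<open>v\<close> and \<open>cnj v\<close>.\<close>

definition closed_form :: "complex set \<Rightarrow> (complex \<Rightarrow> complex \<Rightarrow> 'n::finite cmat) \<Rightarrow> bool" where
  "closed_form \<Omega> \<omega> \<longleftrightarrow>
     (\<forall>v. smooth_on \<Omega> (\<lambda>z. \<omega> z v)) \<and>
     (\<forall>z\<in>\<Omega>. \<forall>v w. frechet_derivative (\<lambda>\<zeta>. \<omega> \<zeta> w) (at z) v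
                   = frechet_derivative (\<lambda>\<zeta>. \<omega> \<zeta> v) (at z) w)"

definition has_line_integral ::
    "(complex \<Rightarrow> complex \<Rightarrow> 'n::finite cmat) \<Rightarrow> (real \<Rightarrow> complex) \<Rightarrow> 'n cmat \<Rightarrow> bool" where
  "has_line_integral \<omega> \<gamma> I \<longleftrightarrow>
     ((\<lambda>t. \<omega> (\<gamma> t) (vector_derivative \<gamma> (at t within {0..1}))) has_integral I) {0..1}"

definition path_in :: "complex set \<Rightarrow> complex \<Rightarrow> complex \<Rightarrow> (real \<Rightarrow> complex) \<Rightarrow> bool" where
  "path_in V a b \<gamma> \<longleftrightarrow>
     valid_path \<gamma> \<and> path_image \<gamma> \<subseteq> V \<and> pathstart \<gamma> = a \<and> pathfinish \<gamma> = b"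


section \<open>Consistency of the descriptions of \<open>A\<^sub>\<lambda>\<close> and \<open>B\<^sub>\<lambda>\<close>\<close>

lemma pos_less: "pos (i::'n::{finite,linorder}) < CARD('n)"
  unfolding pos_def by (rule psubset_card_mono) auto

lemma pos_strict: "i < j \<Longrightarrow> pos (i::'n::{finite,linorder}) < pos j"
  unfolding pos_def by (rule psubset_card_mono) auto

lemma pos_inj: "pos i = pos j \<longleftrightarrow> i = (j::'n::{finite,linorder})"
  by (metis less_irrefl linorder_neqE pos_strict)

lemma pos_image: "pos ` (UNIV::'n::{finite,linorder} set) = {..<CARD('n)}"
  by (rule card_subset_eq) (auto simp: pos_less card_image inj_on_def pos_inj)

lemma pos_ix: "int (pos (ix k :: 'n::{finite,linorder})) = k mod int CARD('n)"
proof -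
  have "nat (k mod int CARD('n)) \<in> {..<CARD('n)}"
    by (simp add: nat_less_iff)
  then obtain i :: 'n where "pos i = nat (k mod int CARD('n))"
    using pos_image by (metis imageE)
  then have "int (pos i) = k mod int CARD('n)"
    by simp
  then show ?thesis
    unfolding ix_def by (rule theI) (metis of_nat_eq_iff pos_inj \<open>int (pos i) = _\<close>)
qed

lemma ix_eq_iff: "ix k = (i::'n::{finite,linorder}) \<longleftrightarrow> int (pos i) = k mod int CARD('n)"
proof -
  have "int (pos i) = int (pos (ix k :: 'n)) \<longleftrightarrow> ix k = i"
    unfolding of_nat_eq_iff pos_inj by blast
  then show ?thesis by (simp add: pos_ix)
qed

lemma ix_pred_iff:
  "ix (int (pos (i::'n)) - 1) = (j::'n::{finite,linorder}) \<longleftrightarrow>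
     pos i = pos j + 1 \<or> pos i = 0 \<and> pos j + 1 = CARD('n)"
proof (cases "pos i = 0")
  case True
  have "(- 1) mod int CARD('n) = int CARD('n) - 1"
    by (simp add: zmod_minus1)
  then show ?thesis using True by (auto simp: ix_eq_iff)
next
  case False
  have "(int (pos i) - 1) mod int CARD('n) = int (pos i) - 1"
    using False pos_less[of i] by simp
  then show ?thesis using False by (auto simp: ix_eq_iff)
qed

lemma ix_succ_iff:
  "ix (int (pos (i::'n)) + 1) = (j::'n::{finite,linorder}) \<longleftrightarrow>
     pos j = pos i + 1 \<or> pos j = 0 \<and> pos i + 1 = CARD('n)"
proof (cases "pos i + 1 = CARD('n)")
  case True
  then have "(int (pos i) + 1) mod int CARD('n) = 0"
    by (metis mod_self of_nat_1 of_nat_add)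
  then show ?thesis using True pos_less[of j] by (auto simp: ix_eq_iff)
next
  case False
  then have "(int (pos i) + 1) mod int CARD('n) = int (pos i) + 1"
    using pos_less[of i] by simp
  then show ?thesis using False by (auto simp: ix_eq_iff)
qed

definition Lam_inv :: "complex \<Rightarrow> 'n::{finite,linorder} cmat" where
  "Lam_inv lam = (\<chi> i j. if ix (int (pos i) + 1) = j then (if pos j = 0 then inverse lam else 1) else 0)"

lemma Lam_alt: "Lam lam = (\<chi> i j::'n::{finite,linorder}.
    if ix (int (pos i) - 1) = j then (if pos i = 0 then lam else 1) else 0)"
  by (auto simp: vec_eq_iff Lam_def ix_pred_iff)

lemma ix_pred_succ: "ix (int (pos (ix (int (pos i) - 1) :: 'n)) + 1) = (i::'n::{finite,linorder})"
  using ix_pred_iff[of i "ix (int (pos i) - 1)"] unfolding ix_succ_iff by simp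

lemma ix_succ_pred: "ix (int (pos (ix (int (pos i) + 1) :: 'n)) - 1) = (i::'n::{finite,linorder})"
  using ix_succ_iff[of i "ix (int (pos i) + 1)"] unfolding ix_pred_iff by simp

lemma diag_mult_nth: "(diag d ** M) $ i $ j = d $ i * M $ i $ j"
  by (simp add: matrix_matrix_mult_def diag_def if_distrib[of "\<lambda>x. x * _"] cong: if_cong)

lemma mult_diag_nth: "(M ** diag d) $ i $ j = M $ i $ j * d $ j"
  by (simp add: matrix_matrix_mult_def diag_def if_distrib[of "\<lambda>x. _ * x"] cong: if_cong)

lemma Lam_mult_diag:
  "Lam lam ** diag d = diag (shift 1 d) ** (Lam lam :: 'n::{finite,linorder} cmat)"
  by (auto simp: vec_eq_iff diag_mult_nth mult_diag_nth shift_def Lam_alt)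

lemma Lam_mult_nth:
  "(Lam lam ** (M :: 'n cmat)) $ i $ j
     = (if pos i = 0 then lam else 1) * M $ ix (int (pos i) - 1) $ (j::'n::{finite,linorder})"
  by (simp add: matrix_matrix_mult_def Lam_alt if_distrib[of "\<lambda>x. x * _"] cong: if_cong)

lemma Lam_inv_mult_nth:
  "(Lam_inv lam ** (M :: 'n cmat)) $ i $ j
     = (if pos (ix (int (pos i) + 1) :: 'n) = 0 then inverse lam else 1)
         * M $ ix (int (pos i) + 1) $ (j::'n::{finite,linorder})"
  by (auto simp add: matrix_matrix_mult_def Lam_inv_def if_distrib[of "\<lambda>x. x * _"] cong: if_cong)

lemma matrix_inv_Lam:
  assumes "lam \<noteq> 0"
  shows "matrix_inv (Lam lam) = (Lam_inv lam :: 'n::{finite,linorder} cmat)"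
proof -
  have "(Lam lam ** Lam_inv lam) $ i $ j = (mat 1 :: 'n cmat) $ i $ j" for i j
    unfolding Lam_mult_nth Lam_inv_def mat_def vec_lambda_beta ix_pred_succ using assms by auto
  then have 1: "Lam lam ** Lam_inv lam = (mat 1 :: 'n cmat)"
    by (simp add: vec_eq_iff)
  have "(Lam_inv lam ** Lam lam) $ i $ j = (mat 1 :: 'n cmat) $ i $ j" for i j
    unfolding Lam_inv_mult_nth Lam_alt mat_def vec_lambda_beta ix_succ_pred using assms by auto
  then have 2: "Lam_inv lam ** Lam lam = (mat 1 :: 'n cmat)"
    by (simp add: vec_eq_iff)
  have "\<exists>M. Lam lam ** M = (mat 1 :: 'n cmat) \<and> M ** Lam lam = mat 1"
    using 1 2 by blast
  then have "matrix_inv (Lam lam) ** Lam lam = (mat 1 :: 'n cmat)"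
    unfolding matrix_inv_def by (rule someI2_ex) blast
  then show ?thesis
    by (metis 1 matrix_mul_assoc matrix_mul_lid matrix_mul_rid)
qed

lemma lp_eval_eq:
  assumes "finite P" and "\<And>p. p \<notin> P \<Longrightarrow> X p = 0"
  shows "lp_eval X lam = (\<Sum>p\<in>P. (lam powi p) *\<^sub>c X p)"
  unfolding lp_eval_def
  by (rule sum.mono_neutral_left) (use assms in \<open>auto simp: cscale_def vec_eq_iff\<close>)

lemma lev_eq:
  assumes "finite P" and "\<And>p. p \<notin> P \<Longrightarrow> a p = 0"
  shows "lev lam a = (\<Sum>p\<in>P. diag (a p) ** mat_pow (Lam lam) p)"
  unfolding lev_def
  by (rule sum.mono_neutral_left)
    (use assms in \<open>auto simp: vec_eq_iff diag_mult_nth\<close>)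

lemma lp_eval_toda_A:
  assumes "CARD('n) \<ge> 2"
  shows "lp_eval (toda_A_coeffs u z) lam = (toda_A lam u z :: 'n::{finite,linorder} cmat)"
proof -
  have "lp_eval (toda_A_coeffs u z) lam
      = (\<Sum>p\<in>{0,1}. (lam powi p) *\<^sub>c toda_A_coeffs u z p :: 'n cmat)"
    by (rule lp_eval_eq) (auto simp: toda_A_coeffs_def)
  then show ?thesis
    using assms by (auto simp: vec_eq_iff cscale_def toda_A_def toda_A_coeffs_def)
qed

lemma cnj_U: "cnj (U u z i j) = U u z i j"
  by (simp add: U_def)

lemma toda_B_entries:
  assumes "CARD('n) \<ge> 2"
  shows "toda_B lam u z = (\<chi> i j::'n::{finite,linorder}.
     if i = j then - cnj (du u z i)
     else if pos j = pos i + 1 then - U u z j i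
     else if pos j = 0 \<and> pos i + 1 = CARD('n) then - inverse lam * U u z j i
     else 0)"
proof -
  have "lp_eval (rho (toda_A_coeffs u z)) lam
      = (\<Sum>p\<in>{0,-1}. (lam powi p) *\<^sub>c rho (toda_A_coeffs u z) p :: 'n cmat)"
    by (rule lp_eval_eq) (auto simp: toda_A_coeffs_def rho_def hconj_def vec_eq_iff)
  then have eq: "toda_B lam u z $ i $ j
      = - cnj (toda_A_coeffs u z 0 $ j $ i) - inverse lam * cnj (toda_A_coeffs u z 1 $ j $ i)"
    for i j :: 'n
    by (simp add: toda_B_def cscale_def rho_def hconj_def power_int_minus)
  have "toda_B lam u z $ i $ j =
     (if i = j then - cnj (du u z i)
      else if pos j = pos i + 1 then - U u z j i
      else if pos j = 0 \<and> pos i + 1 = CARD('n) then - inverse lam * U u z j i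
      else 0)" for i j :: 'n
  proof (cases "i = j")
    case True
    moreover have "\<not> (pos j = 0 \<and> pos j + 1 = CARD('n))" using assms by linarith
    ultimately show ?thesis by (auto simp add: eq toda_A_coeffs_def)
  next
    case False
    then show ?thesis by (simp add: eq toda_A_coeffs_def cnj_U)
  qed
  then show ?thesis by (simp add: vec_eq_iff)
qed

lemma toda_B_unitary:
  assumes "CARD('n) \<ge> 2" and "norm lam = 1"
  shows "toda_B lam u z = - (toda_A lam u z :: 'n::{finite,linorder} cmat)\<^sup>\<dagger>"
proof -
  have "inverse lam = cnj lam"
    using assms(2) by (simp add: inverse_eq_divide divide_conv_cnj)
  then show ?thesis
    using assms(1) by (auto simp: toda_B_entries toda_A_def hconj_def vec_eq_iff cnj_U)
qed

lemma lev_A_ser: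
  assumes "CARD('n) \<ge> 2"
  shows "lev lam (A_ser u z) = (toda_A lam u z :: 'n::{finite,linorder} cmat)"
proof -
  have "lev lam (A_ser u z) = (\<Sum>p\<in>{0,1}. diag (A_ser u z p) ** mat_pow (Lam lam) p :: 'n cmat)"
    by (rule lev_eq) (auto simp: A_ser_def)
  then have eq: "lev lam (A_ser u z) $ i $ j
      = diag (A_ser u z 0) $ i $ j + A_ser u z 1 $ i * Lam lam $ i $ j" for i j :: 'n
    by (simp add: mat_pow_def diag_mult_nth)
  have "lev lam (A_ser u z) $ i $ j = toda_A lam u z $ i $ j" for i j :: 'n
  proof (cases "ix (int (pos i) - 1) = j")
    case True
    then have "i \<noteq> j" and "pos i = pos j + 1 \<or> pos i = 0 \<and> pos j + 1 = CARD('n)"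
      using assms by (auto simp: ix_pred_iff)
    then show ?thesis
      using True by (auto simp: eq A_ser_def Lam_alt diag_def toda_A_def)
  next
    case False
    then have "\<not> (pos i = pos j + 1 \<or> pos i = 0 \<and> pos j + 1 = CARD('n))"
      by (simp add: ix_pred_iff)
    then show ?thesis
      using False by (auto simp: eq A_ser_def Lam_alt diag_def toda_A_def)
  qed
  then show ?thesis by (simp add: vec_eq_iff)
qed

lemma lev_B_ser:
  assumes "CARD('n) \<ge> 2" and "lam \<noteq> 0"
  shows "lev lam (B_ser u z) = (toda_B lam u z :: 'n::{finite,linorder} cmat)"
proof -
  have "lev lam (B_ser u z) = (\<Sum>p\<in>{0,-1}. diag (B_ser u z p) ** mat_pow (Lam lam) p :: 'n cmat)"
    by (rule lev_eq) (auto simp: B_ser_def)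
  then have eq: "lev lam (B_ser u z) $ i $ j
      = diag (B_ser u z 0) $ i $ j + B_ser u z (-1) $ i * Lam_inv lam $ i $ j" for i j :: 'n
    by (simp add: mat_pow_def matrix_inv_Lam[OF assms(2)] diag_mult_nth)
  have "lev lam (B_ser u z) $ i $ j = toda_B lam u z $ i $ j" for i j :: 'n
  proof (cases "ix (int (pos i) + 1) = j")
    case True
    then have "i \<noteq> j" and "pos j = pos i + 1 \<or> pos j = 0 \<and> pos i + 1 = CARD('n)"
      using assms by (auto simp: ix_succ_iff)
    then show ?thesis
      using True
      by (auto simp: eq B_ser_def Lam_inv_def diag_def toda_B_entries[OF assms(1)])
  next
    case False
    then have "\<not> (pos j = pos i + 1 \<or> pos j = 0 \<and> pos i + 1 = CARD('n))"
      by (simp add: ix_succ_iff)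
    then show ?thesis
      using False
      by (auto simp: eq B_ser_def Lam_inv_def diag_def toda_B_entries[OF assms(1)])
  qed
  then show ?thesis by (simp add: vec_eq_iff)
qed

end

theory Submission
  imports Defs "HOL-Complex_Analysis.Riemann_Mapping"
begin

text \<open>
  The algebra behind the theorem is short. Put \<open>S = L + L\<^sup>\<dagger>\<close>. For a spectral parameter of modulus one
  \<open>B = - A\<^sup>\<dagger>\<close>, so taking adjoints in the Lax equations of the trivial flow shows that \<open>S\<close> satisfies them
  as well. The zero curvature equation and the Jacobi identity then turn the equality of mixed
  derivatives into the conservation law for \<open>K = [S, B]\<close> (\<open>conservation_law\<close>). The law says exactly
  that the 1-form \<open>su_form (K z)\<close> is closed (\<open>su_form_closed\<close>), and the form takes values in \<open>su\<close>
  because \<open>K\<close> is a commutator (\<open>su_form_in_su\<close>).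

  Two points need more than algebra. The Wirtinger derivatives obey the product rule only if \<open>L\<close> is
  differentiable, and closedness includes smoothness; the flow equations give neither. Smoothness of
  \<open>L\<close> is inherited from the dressing matrix: the inverse series exists, is unique and is given by a
  recursion that involves only smooth operations on the coefficients (\<open>lmul_assoc\<close>, \<open>linv_eq_rinv\<close>,
  \<open>smooth_flow_L\<close>).

  Secondly, the integral must not depend on the path in an arbitrary simply connected open set. There
  the closed form has a primitive: by the Riemann mapping theorem it suffices to treat convex sets,
  where the Poincare lemma applies (\<open>poincare_convex\<close>, \<open>simply_connected_primitive\<close>). The fundamental
  theorem of calculus identifies line integrals with differences of the primitive
  (\<open>has_line_integral_primitive\<close>), and the primitive vanishing at the base point is the surface \<open>X\<close>.
\<close>

section \<open>Calculus of smooth functions\<close>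

lemma frechet_derivative_cong_open:
  assumes "open S" "z \<in> S" "\<And>w. w \<in> S \<Longrightarrow> f w = g w"
  shows "frechet_derivative f (at z) = frechet_derivative g (at z)"
    and "f differentiable at z \<longleftrightarrow> g differentiable at z"
proof -
  have "(f has_derivative D) (at z) \<longleftrightarrow> (g has_derivative D) (at z)" for D
    using has_derivative_transform_within_open[of f D z UNIV S g]
      has_derivative_transform_within_open[of g D z UNIV S f] assms by auto
  then show "frechet_derivative f (at z) = frechet_derivative g (at z)"
    and "f differentiable at z \<longleftrightarrow> g differentiable at z"
    unfolding frechet_derivative_def differentiable_def by auto
qed

lemma C_on_cong:
  assumes "open S" "\<And>w. w \<in> S \<Longrightarrow> f w = g w"
  shows "C_on k S f \<longleftrightarrow> C_on k S g"
  using assms(2)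
proof (induction k arbitrary: f g)
  case 0
  then show ?case by (simp cong: continuous_on_cong)
next
  case (Suc k)
  have "C_on k S (\<lambda>z. frechet_derivative f (at z) v) \<longleftrightarrow> C_on k S (\<lambda>z. frechet_derivative g (at z) v)" for v
    by (rule Suc.IH) (use frechet_derivative_cong_open(1)[OF assms(1) _ Suc.prems] in auto)
  then show ?case
    using frechet_derivative_cong_open(2)[OF assms(1) _ Suc.prems] by auto
qed

text \<open>The definition of \<open>C_on\<close> speaks of \<open>frechet_derivative\<close>, a choice operator. On an open set any
  explicitly known derivative may take its place, and this is how every closure property below is
  proved: by induction on the order, from the corresponding differentiation rule.\<close>

lemma C_on_SucI:
  assumes "open S" "\<And>z. z \<in> S \<Longrightarrow> (f has_derivative D z) (at z)" "\<And>v. C_on k S (\<lambda>z. D z v)"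
  shows "C_on (Suc k) S f"
proof -
  have *: "frechet_derivative f (at z) = D z" if "z \<in> S" for z
    using frechet_derivative_at[OF assms(2)[OF that]] by simp
  have "C_on k S (\<lambda>z. frechet_derivative f (at z) v)" for v
    using assms(3)[of v] by (subst C_on_cong[OF assms(1), where g = "\<lambda>z. D z v"]) (simp_all add: *)
  with assms(2) show ?thesis by (auto simp: differentiable_def)
qed

lemma C_on_has_derivative:
  "C_on (Suc k) S f \<Longrightarrow> z \<in> S \<Longrightarrow> (f has_derivative frechet_derivative f (at z)) (at z)"
  by (simp add: frechet_derivative_works)

lemma C_on_SucD: "C_on (Suc k) S f \<Longrightarrow> C_on k S f"
proof (induction k arbitrary: f)
  case 0
  then show ?case
    by (auto intro!: continuous_at_imp_continuous_on differentiable_imp_continuous_within)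
next
  case (Suc k)
  then have "C_on k S (\<lambda>z. frechet_derivative f (at z) v)" for v
    using C_on.simps(2)[of "Suc k" S f] by blast
  moreover have "\<forall>z\<in>S. f differentiable (at z)"
    using Suc.prems C_on.simps(2)[of "Suc k" S f] by blast
  ultimately show ?case by simp
qed

lemma C_on_mono: "C_on k S f \<Longrightarrow> S' \<subseteq> S \<Longrightarrow> C_on k S' f"
  by (induction k arbitrary: f) (auto intro: continuous_on_subset)

lemma C_on_const: "open S \<Longrightarrow> C_on k S (\<lambda>_. c)"
proof (induction k arbitrary: c)
  case (Suc k)
  show ?case by (rule C_on_SucI[OF Suc.prems, where D = "\<lambda>_ _. 0"]) (use Suc in auto)
qed auto

lemma C_on_add:
  assumes "open S" shows "C_on k S f \<Longrightarrow> C_on k S g \<Longrightarrow> C_on k S (\<lambda>z. f z + g z)"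
proof (induction k arbitrary: f g)
  case (Suc k)
  show ?case
    by (rule C_on_SucI[OF assms has_derivative_add[OF C_on_has_derivative C_on_has_derivative]])
      (use Suc in auto)
qed (auto intro: continuous_on_add)

lemma C_on_linear:
  assumes "open S" "bounded_linear h" shows "C_on k S f \<Longrightarrow> C_on k S (\<lambda>z. h (f z))"
proof (induction k arbitrary: f)
  case 0
  then show ?case using assms(2) by (auto intro: bounded_linear.continuous_on)
next
  case (Suc k)
  show ?case
    by (rule C_on_SucI[OF assms(1) bounded_linear.has_derivative[OF assms(2) C_on_has_derivative]])
      (use Suc in auto)
qed

lemma C_on_bilinear:
  assumes "open S" "bounded_bilinear p"
  shows "C_on k S f \<Longrightarrow> C_on k S g \<Longrightarrow> C_on k S (\<lambda>z. p (f z) (g z))"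
proof (induction k arbitrary: f g)
  case 0
  then show ?case using assms(2) by (auto intro: bounded_bilinear.continuous_on)
next
  case (Suc k)
  have f: "C_on k S f" "C_on k S (\<lambda>z. frechet_derivative f (at z) v)" for v
    using C_on_SucD[OF Suc.prems(1)] Suc.prems(1) by simp_all
  have g: "C_on k S g" "C_on k S (\<lambda>z. frechet_derivative g (at z) v)" for v
    using C_on_SucD[OF Suc.prems(2)] Suc.prems(2) by simp_all
  have d: "((\<lambda>z. p (f z) (g z)) has_derivative
      (\<lambda>v. p (f z) (frechet_derivative g (at z) v) + p (frechet_derivative f (at z) v) (g z))) (at z)"
    if "z \<in> S" for z
    by (rule bounded_bilinear.FDERIV[OF assms(2)
          C_on_has_derivative[OF Suc.prems(1) that] C_on_has_derivative[OF Suc.prems(2) that]])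
  have "C_on k S (\<lambda>z. p (f z) (frechet_derivative g (at z) v) + p (frechet_derivative f (at z) v) (g z))" for v
    by (intro C_on_add[OF assms(1)] Suc.IH f g)
  with d show ?case
    using C_on_SucI[OF assms(1), where k = k and D = "\<lambda>z v. p (f z) (frechet_derivative g (at z) v) +
      p (frechet_derivative f (at z) v) (g z)"] by blast
qed

text \<open>The derivative of \<open>1 / f\<close> contains \<open>1 / f\<close> itself, but only to order \<open>k\<close> when \<open>f\<close> is of order
  \<open>k + 1\<close>; hence the induction closes. The same remark applies to \<open>exp f\<close>.\<close>

lemma C_on_inverse:
  fixes f :: "complex \<Rightarrow> 'b::real_normed_field"
  assumes "open S"
  shows "C_on k S f \<Longrightarrow> (\<And>z. z \<in> S \<Longrightarrow> f z \<noteq> 0) \<Longrightarrow> C_on k S (\<lambda>z. inverse (f z))"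
proof (induction k arbitrary: f)
  case 0
  then show ?case by (auto intro!: continuous_on_inverse)
next
  case (Suc k)
  have inv: "C_on k S (\<lambda>z. inverse (f z))"
    using Suc.IH[OF C_on_SucD[OF Suc.prems(1)] Suc.prems(2)] .
  have df: "C_on k S (\<lambda>z. frechet_derivative f (at z) v)" for v
    using Suc.prems(1) by simp
  have d: "((\<lambda>z. inverse (f z)) has_derivative
      (\<lambda>v. - (inverse (f z) * frechet_derivative f (at z) v * inverse (f z)))) (at z)" if "z \<in> S" for z
    by (rule Deriv.has_derivative_inverse[OF Suc.prems(2)[OF that] C_on_has_derivative[OF Suc.prems(1) that]])
  note mult = C_on_bilinear[OF assms bounded_bilinear_mult]
  have "C_on k S (\<lambda>z. - (inverse (f z) * frechet_derivative f (at z) v * inverse (f z)))" for v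
    by (intro C_on_linear[OF assms bounded_linear_minus[OF bounded_linear_ident]] mult inv df)
  with d show ?case
    using C_on_SucI[OF assms, where k = k and D = "\<lambda>z v. - (inverse (f z) * frechet_derivative f (at z) v * inverse (f z))"] by blast
qed

lemma C_on_exp:
  fixes f :: "complex \<Rightarrow> 'b::{real_normed_field,banach}"
  assumes "open S" shows "C_on k S f \<Longrightarrow> C_on k S (\<lambda>z. exp (f z))"
proof (induction k arbitrary: f)
  case 0
  then show ?case by (auto intro!: continuous_on_exp)
next
  case (Suc k)
  have e: "C_on k S (\<lambda>z. exp (f z))"
    using Suc.IH[OF C_on_SucD[OF Suc.prems(1)]] .
  have d: "((\<lambda>z. exp (f z)) has_derivative (\<lambda>v. exp (f z) * frechet_derivative f (at z) v)) (at z)"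
    if "z \<in> S" for z
    using has_derivative_compose[OF C_on_has_derivative[OF Suc.prems(1) that] has_field_derivative_imp_has_derivative[OF DERIV_exp]]
    by simp
  have df: "C_on k S (\<lambda>z. frechet_derivative f (at z) v)" for v
    using Suc.prems(1) by simp
  have "C_on k S (\<lambda>z. exp (f z) * frechet_derivative f (at z) v)" for v
    by (rule C_on_bilinear[OF assms bounded_bilinear_mult e df])
  with d show ?case
    using C_on_SucI[OF assms, where k = k and D = "\<lambda>z v. exp (f z) * frechet_derivative f (at z) v"] by blast
qed

lemma smooth_on_cong:
  "open S \<Longrightarrow> (\<And>w. w \<in> S \<Longrightarrow> f w = g w) \<Longrightarrow> smooth_on S f \<longleftrightarrow> smooth_on S g"
  unfolding smooth_on_def using C_on_cong by blast

lemma smooth_on_mono: "smooth_on S f \<Longrightarrow> S' \<subseteq> S \<Longrightarrow> smooth_on S' f"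
  unfolding smooth_on_def using C_on_mono by blast

lemma smooth_on_const: "open S \<Longrightarrow> smooth_on S (\<lambda>_. c)"
  by (simp add: smooth_on_def C_on_const)

lemma smooth_on_add: "open S \<Longrightarrow> smooth_on S f \<Longrightarrow> smooth_on S g \<Longrightarrow> smooth_on S (\<lambda>z. f z + g z)"
  by (simp add: smooth_on_def C_on_add)

lemma smooth_on_linear: "bounded_linear h \<Longrightarrow> open S \<Longrightarrow> smooth_on S f \<Longrightarrow> smooth_on S (\<lambda>z. h (f z))"
  by (simp add: smooth_on_def C_on_linear)

lemma smooth_on_bilinear:
  "bounded_bilinear p \<Longrightarrow> open S \<Longrightarrow> smooth_on S f \<Longrightarrow> smooth_on S g \<Longrightarrow> smooth_on S (\<lambda>z. p (f z) (g z))"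
  by (simp add: smooth_on_def C_on_bilinear)

lemmas smooth_on_mult = smooth_on_bilinear[OF bounded_bilinear_mult]
lemmas smooth_on_minus = smooth_on_linear[OF bounded_linear_minus[OF bounded_linear_ident]]

lemma smooth_on_diff: "open S \<Longrightarrow> smooth_on S f \<Longrightarrow> smooth_on S g \<Longrightarrow> smooth_on S (\<lambda>z. f z - g z)"
  using smooth_on_add[OF _ _ smooth_on_minus, of S f g] by simp

lemma smooth_on_sum:
  "open S \<Longrightarrow> (\<And>i. i \<in> I \<Longrightarrow> smooth_on S (f i)) \<Longrightarrow> smooth_on S (\<lambda>z. \<Sum>i\<in>I. f i z)"
  by (induction I rule: infinite_finite_induct) (auto intro: smooth_on_const smooth_on_add)

lemma smooth_on_inverse:
  fixes f :: "complex \<Rightarrow> 'b::real_normed_field"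
  shows "open S \<Longrightarrow> smooth_on S f \<Longrightarrow> (\<And>z. z \<in> S \<Longrightarrow> f z \<noteq> 0) \<Longrightarrow> smooth_on S (\<lambda>z. inverse (f z))"
  by (simp add: smooth_on_def C_on_inverse)

lemma smooth_on_exp:
  fixes f :: "complex \<Rightarrow> 'b::{real_normed_field,banach}"
  shows "open S \<Longrightarrow> smooth_on S f \<Longrightarrow> smooth_on S (\<lambda>z. exp (f z))"
  by (simp add: smooth_on_def C_on_exp)

lemma smooth_on_has_derivative:
  "smooth_on S f \<Longrightarrow> z \<in> S \<Longrightarrow> (f has_derivative frechet_derivative f (at z)) (at z)"
  unfolding smooth_on_def using C_on_has_derivative by blast

lemma smooth_on_derivative: "smooth_on S f \<Longrightarrow> smooth_on S (\<lambda>z. frechet_derivative f (at z) v)"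
  unfolding smooth_on_def
proof
  fix k assume "\<forall>k. C_on k S f"
  then have "C_on (Suc k) S f" by blast
  then show "C_on k S (\<lambda>z. frechet_derivative f (at z) v)" by simp
qed

lemma smooth_on_continuous_on: "smooth_on S f \<Longrightarrow> continuous_on S f"
  unfolding smooth_on_def by (metis C_on.simps(1))

text \<open>A function gains one order of smoothness over its derivative, so a smooth derivative suffices.\<close>

lemma smooth_on_primitive:
  assumes "open S" "\<And>z. z \<in> S \<Longrightarrow> (f has_derivative D z) (at z)" "\<And>v. smooth_on S (\<lambda>z. D z v)"
  shows "smooth_on S f"
  unfolding smooth_on_def
proof
  fix k
  have "C_on (Suc k) S f"
    using assms by (intro C_on_SucI) (auto simp: smooth_on_def)
  then show "C_on k S f" by (rule C_on_SucD)
qed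

lemma smooth_on_nth:
  fixes f :: "complex \<Rightarrow> 'b::real_normed_vector^'n"
  shows "open S \<Longrightarrow> smooth_on S f \<Longrightarrow> smooth_on S (\<lambda>z. f z $ i)"
  by (rule smooth_on_linear[OF bounded_linear_vec_nth])

lemma bounded_linear_axis: "bounded_linear (axis i :: 'b::real_normed_vector \<Rightarrow> 'b^'n)"
proof (rule bounded_linear_intro[where K = 1])
  show "norm (axis i x :: 'b^'n) \<le> norm x * 1" for x
    by (simp add: norm_vec_def axis_def L2_set_def if_distrib[of norm] if_distrib[of "\<lambda>x. x\<^sup>2"] cong: if_cong)
qed (auto simp: axis_def vec_eq_iff)

lemma smooth_on_vec:
  fixes f :: "complex \<Rightarrow> 'b::real_normed_vector^'n"
  assumes "open S" "\<And>i. smooth_on S (\<lambda>z. f z $ i)"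
  shows "smooth_on S f"
proof -
  have eq: "f = (\<lambda>z. \<Sum>i\<in>UNIV. axis i (f z $ i))"
    by (auto simp: vec_eq_iff axis_def fun_eq_iff)
  have "smooth_on S (\<lambda>z. axis i (f z $ i) :: 'b^'n)" for i
    by (rule smooth_on_linear[OF bounded_linear_axis assms(1) assms(2)])
  then show ?thesis
    by (subst eq) (intro smooth_on_sum assms(1))
qed

lemma smooth_on_mat:
  fixes f :: "complex \<Rightarrow> 'b::real_normed_vector^'n^'m"
  assumes "open S" "\<And>i j. smooth_on S (\<lambda>z. f z $ i $ j)"
  shows "smooth_on S f"
  using assms by (intro smooth_on_vec) auto


section \<open>The algebra of formal series\<close>

lemma ix_pos: "ix (int (pos i)) = (i::'n::{finite,linorder})"
  using pos_less[of i] by (simp add: ix_eq_iff)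

text \<open>The residue of a row number modulo \<open>CARD('n)\<close> may be taken before or after subtracting, so shifts
  compose; this is the law \<open>\<Lambda>\<^sup>i \<Lambda>\<^sup>j = \<Lambda>\<^sup>i\<^sup>+\<^sup>j\<close> read on diagonals.\<close>

lemma shift_shift: "shift i (shift j d) = shift (i + j) (d :: complex^'n::{finite,linorder})"
proof -
  have "ix (int (pos (ix (int (pos x) - i) :: 'n)) - j) = (ix (int (pos x) - (i + j)) :: 'n)" for x :: 'n
    by (simp add: ix_eq_iff pos_ix mod_diff_left_eq diff_diff_eq)
  then show ?thesis by (simp add: shift_def vec_eq_iff)
qed

lemma shift_0 [simp]: "shift 0 d = d"
  by (simp add: shift_def vec_eq_iff ix_pos)

lemma shift_zero [simp]: "shift k 0 = 0"
  by (simp add: shift_def vec_eq_iff)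

lemma shift_one [simp]: "shift k 1 = 1"
  by (simp add: shift_def vec_eq_iff)

lemma shift_mult: "shift k (a * b) = shift k a * shift k b"
  by (simp add: shift_def vec_eq_iff)

lemma shift_sum: "shift k (\<Sum>i\<in>I. f i) = (\<Sum>i\<in>I. shift k (f i))"
  by (simp add: shift_def vec_eq_iff)

lemma lmul_eq_sum:
  assumes "finite P" "\<And>i. i \<notin> P \<Longrightarrow> a i = 0 \<or> b (k - i) = 0"
  shows "lmul a b k = (\<Sum>i\<in>P. a i * shift i (b (k - i)))"
  unfolding lmul_def by (rule sum.mono_neutral_left) (use assms in auto)

definition vanishes_above :: "int \<Rightarrow> 'n::finite lser \<Rightarrow> bool" where
  "vanishes_above K a \<longleftrightarrow> (\<forall>k>K. a k = 0)"

text \<open>The sum that defines a coefficient of a product ranges over a set depending on the zeros of the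
  factors. Bounds on the exponents allow one to replace it by an interval that does not; for
  series depending on a point of the plane, this makes the coefficients finite sums of smooth
  functions.\<close>

lemma lmul_interval:
  assumes "vanishes_above Ka a" "vanishes_above Kb b" "l \<le> k - Kb" "Ka \<le> h"
  shows "lmul a b k = (\<Sum>i\<in>{l..h}. a i * shift i (b (k - i)))"
  by (rule lmul_eq_sum) (use assms in \<open>auto simp: vanishes_above_def\<close>)

lemma vanishes_above_lmul:
  assumes "vanishes_above Ka a" "vanishes_above Kb b"
  shows "vanishes_above (Ka + Kb) (lmul a b)"
  unfolding vanishes_above_def
proof (intro allI impI)
  fix k assume k: "Ka + Kb < k"
  have "a i = 0 \<or> b (k - i) = 0" for i
    using assms k by (cases "i \<le> Ka") (auto simp: vanishes_above_def)
  then have "lmul a b k = (\<Sum>i\<in>{}. a i * shift i (b (k - i)))"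
    by (intro lmul_eq_sum) auto
  then show "lmul a b k = 0" by simp
qed

lemma lmul_assoc:
  assumes a: "vanishes_above Ka a" and b: "vanishes_above Kb b" and c: "vanishes_above Kc c"
  shows "lmul (lmul a b) c = lmul a (lmul b c)"
proof
  fix k
  define J where "J = {k - Kb - Kc..Ka}"
  define I where "I = {k - Kc..Ka + Kb}"
  define t where "t i j = a j * shift j (b (i - j)) * shift i (c (k - i))" for i j
  have "lmul (lmul a b) c k = (\<Sum>i\<in>I. lmul a b i * shift i (c (k - i)))"
    unfolding I_def by (rule lmul_interval[OF vanishes_above_lmul[OF a b] c]) auto
  also have "\<dots> = (\<Sum>i\<in>I. \<Sum>j\<in>J. t i j)"
  proof (rule sum.cong[OF refl])
    fix i assume "i \<in> I"
    then have "lmul a b i = (\<Sum>j\<in>J. a j * shift j (b (i - j)))"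
      unfolding J_def I_def by (intro lmul_interval[OF a b]) auto
    then show "lmul a b i * shift i (c (k - i)) = (\<Sum>j\<in>J. t i j)"
      by (simp add: sum_distrib_right t_def)
  qed
  also have "\<dots> = (\<Sum>j\<in>J. \<Sum>i\<in>I. t i j)"
    by (rule sum.swap)
  also have "\<dots> = (\<Sum>j\<in>J. a j * shift j (lmul b c (k - j)))"
  proof (rule sum.cong[OF refl])
    fix j assume "j \<in> J"
    have "lmul b c (k - j) = (\<Sum>l\<in>{k - Kc - j..Ka + Kb - j}. b l * shift l (c (k - j - l)))"
      by (rule lmul_interval[OF b c]) (use \<open>j \<in> J\<close> in \<open>auto simp: J_def\<close>)
    also have "\<dots> = (\<Sum>i\<in>I. b (i - j) * shift (i - j) (c (k - i)))"
      unfolding I_def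
      by (rule sum.reindex_bij_witness[where i = "\<lambda>i. i - j" and j = "\<lambda>l. l + j"])
        (auto simp: algebra_simps)
    finally show "(\<Sum>i\<in>I. t i j) = a j * shift j (lmul b c (k - j))"
      by (simp add: shift_sum shift_mult shift_shift sum_distrib_left t_def mult.assoc)
  qed
  also have "\<dots> = lmul a (lmul b c) k"
    unfolding J_def by (rule lmul_interval[OF a vanishes_above_lmul[OF b c], symmetric]) auto
  finally show "lmul (lmul a b) c k = lmul a (lmul b c) k" .
qed

lemma lmul_one_left: "lmul (Lam_ser 0) a = a"
proof
  fix k
  have "lmul (Lam_ser 0) a k = (\<Sum>i\<in>{0}. Lam_ser 0 i * shift i (a (k - i)))"
    by (rule lmul_eq_sum) (auto simp: Lam_ser_def)
  then show "lmul (Lam_ser 0) a k = a k" by (simp add: Lam_ser_def)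
qed

lemma lmul_one_right: "lmul a (Lam_ser 0) = a"
proof
  fix k
  have "lmul a (Lam_ser 0) k = (\<Sum>i\<in>{k}. a i * shift i (Lam_ser 0 (k - i)))"
    by (rule lmul_eq_sum) (auto simp: Lam_ser_def)
  then show "lmul a (Lam_ser 0) k = a k" by (simp add: Lam_ser_def)
qed

text \<open>The coefficient of \<open>\<Lambda>\<^sup>-\<^sup>k\<close> in the right inverse of \<open>\<Sum>\<^sub>j a\<^bsub>-j\<^esub> \<Lambda>\<^sup>-\<^sup>j\<close>, obtained by solving the equation for
  the coefficient of \<open>\<Lambda>\<^sup>-\<^sup>k\<close> in the product for the unknown that is multiplied by \<open>a\<^sub>0\<close>. The only
  divisions are by the entries of \<open>a\<^sub>0\<close>.\<close>

fun rinv_coeff :: "'n::{finite,linorder} lser \<Rightarrow> nat \<Rightarrow> complex^'n::{finite,linorder}" where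
  "rinv_coeff a k = (\<chi> i. inverse (a 0 $ i) * ((if k = 0 then 1 else 0)
     - (\<Sum>j<k. a (- int (k - j)) $ i * shift (- int (k - j)) (rinv_coeff a j) $ i)))"

declare rinv_coeff.simps [simp del]

definition rinv :: "'n::{finite,linorder} lser \<Rightarrow> 'n lser" where
  "rinv a k = (if k \<le> 0 then rinv_coeff a (nat (- k)) else 0)"

lemma vanishes_above_rinv: "vanishes_above 0 (rinv a)"
  by (simp add: vanishes_above_def rinv_def)

lemma rinv_0: "rinv a 0 $ i = inverse (a 0 $ i)"
  unfolding rinv_def by (subst rinv_coeff.simps) simp

lemma lmul_rinv:
  assumes "vanishes_above 0 a" "\<And>i. a 0 $ i \<noteq> 0"
  shows "lmul a (rinv a) = Lam_ser 0"
proof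
  fix k :: int
  show "lmul a (rinv a) k = Lam_ser 0 k"
  proof (cases "k > 0")
    case True
    then show ?thesis
      using vanishes_above_lmul[OF assms(1) vanishes_above_rinv[of a]]
      by (simp add: vanishes_above_def Lam_ser_def)
  next
    case False
    define n where "n = nat (- k)"
    then have k: "k = - int n" using False by simp
    have "lmul a (rinv a) k = (\<Sum>i\<in>{k..0}. a i * shift i (rinv a (k - i)))"
      by (rule lmul_interval[OF assms(1) vanishes_above_rinv]) auto
    also have "\<dots> = (\<Sum>j\<in>{..n}. a (- int (n - j)) * shift (- int (n - j)) (rinv_coeff a j))"
      by (rule sum.reindex_bij_witness[where i = "\<lambda>j. - int (n - j)" and j = "\<lambda>i. nat (i - k)"])
        (auto simp: k rinv_def)
    also have "\<dots> = (\<Sum>j<n. a (- int (n - j)) * shift (- int (n - j)) (rinv_coeff a j)) + a 0 * rinv_coeff a n"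
      by (simp add: lessThan_Suc_atMost[symmetric])
    \<comment> \<open>the last summand was chosen to cancel all the others, up to the constant term of the unit series\<close>
    also have "\<dots> = (\<chi> i. if n = 0 then 1 else 0)"
      unfolding vec_eq_iff
      by (subst (2) rinv_coeff.simps) (simp add: assms(2) mult.assoc[symmetric])
    also have "\<dots> = Lam_ser 0 k"
      by (auto simp: Lam_ser_def k vec_eq_iff)
    finally show ?thesis .
  qed
qed

text \<open>The right inverse is again a series with invertible leading coefficient, so it has a right inverse
  too; associativity identifies the latter with the original series.\<close>

lemma rinv_lmul:
  assumes "vanishes_above 0 a" "\<And>i. a 0 $ i \<noteq> 0"
  shows "lmul (rinv a) a = Lam_ser 0"
proof -
  note v = vanishes_above_rinv
  have r: "lmul (rinv a) (rinv (rinv a)) = Lam_ser 0"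
    using assms(2) by (intro lmul_rinv v) (simp add: rinv_0)
  have "a = lmul a (lmul (rinv a) (rinv (rinv a)))"
    by (simp add: r lmul_one_right)
  also have "\<dots> = lmul (lmul a (rinv a)) (rinv (rinv a))"
    by (rule lmul_assoc[OF assms(1) v v, symmetric])
  also have "\<dots> = rinv (rinv a)"
    by (simp add: lmul_rinv[OF assms] lmul_one_left)
  finally show ?thesis using r by simp
qed

text \<open>The inverse is defined by a description. It denotes the series constructed above because a
  two-sided inverse with bounded exponents is unique, by associativity.\<close>

lemma linv_eq_rinv:
  assumes "vanishes_above 0 a" "\<And>i. a 0 $ i \<noteq> 0"
  shows "linv a = rinv a"
  unfolding linv_def
proof (rule the_equality)
  show "bdd_ser (rinv a) \<and> lmul a (rinv a) = Lam_ser 0 \<and> lmul (rinv a) a = Lam_ser 0"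
    using vanishes_above_rinv[of a] lmul_rinv[OF assms] rinv_lmul[OF assms]
    by (auto simp: bdd_ser_def vanishes_above_def)
next
  fix b assume b: "bdd_ser b \<and> lmul a b = Lam_ser 0 \<and> lmul b a = Lam_ser 0"
  then obtain K where K: "vanishes_above K b" by (auto simp: bdd_ser_def vanishes_above_def)
  have "b = lmul (lmul b a) (rinv a) "
    using lmul_rinv[OF assms] by (simp add: lmul_assoc[OF K assms(1) vanishes_above_rinv] lmul_one_right)
  then show "b = rinv a" using b by (simp add: lmul_one_left)
qed


section \<open>Smoothness of the flow matrix\<close>

lemma smooth_on_shift:
  "open S \<Longrightarrow> smooth_on S f \<Longrightarrow> smooth_on S (\<lambda>z. shift k (f z))"
  by (intro smooth_on_vec) (auto simp: shift_def intro: smooth_on_nth)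

lemma smooth_on_vec_mult:
  fixes f g :: "complex \<Rightarrow> complex^'n::finite"
  shows "open S \<Longrightarrow> smooth_on S f \<Longrightarrow> smooth_on S g \<Longrightarrow> smooth_on S (\<lambda>z. f z * g z)"
  by (intro smooth_on_vec) (auto intro!: smooth_on_mult smooth_on_nth)

lemma smooth_on_lmul:
  assumes "open S" "\<And>z. z \<in> S \<Longrightarrow> vanishes_above Ka (a z)" "\<And>z. z \<in> S \<Longrightarrow> vanishes_above Kb (b z)"
    "\<And>k. smooth_on S (\<lambda>z. a z k)" "\<And>k. smooth_on S (\<lambda>z. b z k)"
  shows "smooth_on S (\<lambda>z. lmul (a z) (b z) k)"
proof -
  have "smooth_on S (\<lambda>z. \<Sum>i\<in>{k - Kb..Ka}. a z i * shift i (b z (k - i)))"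
    by (intro smooth_on_sum smooth_on_vec_mult smooth_on_shift assms)
  then show ?thesis
    by (subst smooth_on_cong[OF assms(1) lmul_interval[OF assms(2,3)]]) auto
qed

lemma smooth_on_rinv:
  assumes "open S" "\<And>k. smooth_on S (\<lambda>z. a z k)" "\<And>z i. z \<in> S \<Longrightarrow> a z 0 $ i \<noteq> 0"
  shows "smooth_on S (\<lambda>z. rinv (a z) k)"
proof -
  have *: "smooth_on S (\<lambda>z. rinv_coeff (a z) n)" for n
  proof (induction n rule: less_induct)
    case (less n)
    have "smooth_on S (\<lambda>z. inverse (a z 0 $ i) * ((if n = 0 then 1 else 0)
       - (\<Sum>j<n. a z (- int (n - j)) $ i * shift (- int (n - j)) (rinv_coeff (a z) j) $ i)))" for i
      by (intro smooth_on_mult smooth_on_inverse smooth_on_diff smooth_on_const smooth_on_sum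
          smooth_on_nth smooth_on_shift assms less) auto
    then show ?case
      by (intro smooth_on_vec assms(1)) (subst rinv_coeff.simps, simp)
  qed
  show ?thesis
    by (cases "k \<le> 0") (simp_all add: rinv_def * smooth_on_const[OF assms(1)])
qed

text \<open>Every coefficient of \<open>T \<Lambda>\<^sup>m T\<^sup>-\<^sup>1\<close> is a polynomial in shifted entries of the coefficients of \<open>T\<close> and in the
  reciprocals of the entries of its leading coefficient. The truncation keeps the powers \<open>0, \<dots>, m\<close>
  at every point.\<close>

lemma smooth_flow_L:
  assumes "open \<Omega>" "dressing \<Omega> u T"
  shows "smooth_on \<Omega> (flow_L lam m T :: complex \<Rightarrow> 'n::{finite,linorder} cmat)"
proof -
  have T: "\<And>k. smooth_on \<Omega> (\<lambda>z. T z k)" "\<And>z. z \<in> \<Omega> \<Longrightarrow> vanishes_above 0 (T z)"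
    "\<And>z i. z \<in> \<Omega> \<Longrightarrow> T z 0 $ i \<noteq> 0"
    using assms(2) by (auto simp: dressing_def smooth_lser_on_def vanishes_above_def)
  define M where "M z = lmul (lmul (T z) (Lam_ser m)) (rinv (T z))" for z
  have m: "vanishes_above (int m) (Lam_ser m :: 'n lser)"
    by (simp add: vanishes_above_def Lam_ser_def)
  have TL: "vanishes_above (int m) (lmul (T z) (Lam_ser m))" if "z \<in> \<Omega>" for z
    using vanishes_above_lmul[OF T(2)[OF that] m] by simp
  have M: "vanishes_above (int m) (M z)" if "z \<in> \<Omega>" for z
    using vanishes_above_lmul[OF TL[OF that] vanishes_above_rinv] by (simp add: M_def)
  have smooth_M: "smooth_on \<Omega> (\<lambda>z. M z k)" for k
    unfolding M_def
    by (intro smooth_on_lmul[OF assms(1) TL vanishes_above_rinv] smooth_on_lmul[OF assms(1) T(2) m]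
        smooth_on_rinv T assms(1) smooth_on_const)
  have L: "flow_L lam m T z = (\<Sum>k\<in>{0..int m}. diag (M z k) ** mat_pow (Lam lam) k)" if "z \<in> \<Omega>" for z
  proof -
    have "flow_L lam m T z = lev lam (lplus (M z))"
      using linv_eq_rinv[OF T(2,3)[OF that]] by (simp add: flow_L_def M_def)
    also have "\<dots> = (\<Sum>k\<in>{0..int m}. diag (lplus (M z) k) ** mat_pow (Lam lam) k)"
      using M[OF that] by (intro lev_eq) (auto simp: lplus_def vanishes_above_def)
    finally show ?thesis by (simp add: lplus_def)
  qed
  have "smooth_on \<Omega> (\<lambda>z. (\<Sum>k\<in>{0..int m}. diag (M z k) ** mat_pow (Lam lam) k) :: 'n cmat)"
    by (intro smooth_on_sum smooth_on_mat assms(1))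
      (auto simp: diag_mult_nth intro!: smooth_on_mult smooth_on_nth smooth_M smooth_on_const assms(1))
  then show ?thesis
    by (subst smooth_on_cong[OF assms(1) L]) auto
qed

lemma smooth_dz:
  assumes "open S" "smooth_on S f" shows "smooth_on S (dz f)"
proof -
  have "smooth_on S (\<lambda>z. 1 / 2 * (frechet_derivative f (at z) 1 - \<i> * frechet_derivative f (at z) \<i>))"
    using assms by (intro smooth_on_mult smooth_on_diff smooth_on_const smooth_on_derivative)
  then show ?thesis unfolding dz_def[abs_def] by simp
qed

lemma smooth_toda_A:
  fixes u :: "'n::{finite,linorder} field_tuple"
  assumes "open \<Omega>" "\<And>i. smooth_on \<Omega> (u i)"
  shows "smooth_on \<Omega> (toda_A lam u)"
proof (rule smooth_on_mat[OF assms(1)])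
  fix i j :: 'n
  have U: "smooth_on \<Omega> (\<lambda>z. U u z i j)"
    unfolding U_def
    by (intro smooth_on_linear[OF bounded_linear_of_real] smooth_on_exp smooth_on_diff assms)
  have "smooth_on \<Omega> (\<lambda>z. du u z i)"
    unfolding du_def by (intro smooth_dz smooth_on_linear[OF bounded_linear_of_real] assms)
  with U show "smooth_on \<Omega> (\<lambda>z. toda_A lam u z $ i $ j)"
    unfolding toda_A_def
    by (cases "i = j"; cases "pos i = pos j + 1"; cases "pos i = 0"; cases "pos j + 1 = CARD('n)")
      (simp_all add: smooth_on_mult smooth_on_const assms(1))
qed


section \<open>Primitives of closed 1-forms\<close>

text \<open>Expanding the second argument in the basis turns continuity for each fixed vector into joint
  continuity.\<close>

lemma continuous_on_linear_family:
  fixes D :: "'a::topological_space \<Rightarrow> 'b::euclidean_space \<Rightarrow> 'c::real_normed_vector"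
  assumes lin: "\<And>z. z \<in> S \<Longrightarrow> linear (D z)" and c: "\<And>h. continuous_on S (\<lambda>z. D z h)"
    and p: "continuous_on R p" "p ` R \<subseteq> S" and q: "continuous_on R q"
  shows "continuous_on R (\<lambda>x. D (p x) (q x))"
proof -
  have "D (p x) (q x) = (\<Sum>b\<in>Basis. (q x \<bullet> b) *\<^sub>R D (p x) b)" if "x \<in> R" for x
  proof -
    have l: "linear (D (p x))" using lin p that by auto
    have "D (p x) (q x) = D (p x) (\<Sum>b\<in>Basis. (q x \<bullet> b) *\<^sub>R b)"
      by (simp add: euclidean_representation)
    also have "\<dots> = (\<Sum>b\<in>Basis. (q x \<bullet> b) *\<^sub>R D (p x) b)"
      by (simp add: linear_sum[OF l] linear_scale[OF l])
    finally show ?thesis .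
  qed
  moreover have "continuous_on R (\<lambda>x. \<Sum>b\<in>Basis. (q x \<bullet> b) *\<^sub>R D (p x) b)"
    by (intro continuous_intros q continuous_on_compose2[OF c p])
  ultimately show ?thesis by (simp cong: continuous_on_cong)
qed

text \<open>The primitive is \<open>Y(x) = \<integral>\<^sub>0\<^sup>1 \<eta>\<^bsub>tx\<^esub>(x) dt\<close>. Differentiating under the integral sign produces
  \<open>\<eta>\<^bsub>tx\<^esub>(h) + t \<eta>'\<^bsub>tx\<^esub>(h)(x)\<close>. Closedness exchanges \<open>h\<close> and \<open>x\<close>, and the result is the \<open>t\<close>-derivative of
  \<open>t \<eta>\<^bsub>tx\<^esub>(h)\<close>, whose integral is \<open>\<eta>\<^sub>x(h)\<close>.\<close>

lemma poincare_convex: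
  fixes \<eta> :: "'a::euclidean_space \<Rightarrow> 'a \<Rightarrow>\<^sub>L 'b::banach"
  assumes "open S" "convex S" "0 \<in> S"
    and d: "\<And>z. z \<in> S \<Longrightarrow> (\<eta> has_derivative \<eta>' z) (at z)"
    and c: "\<And>h. continuous_on S (\<lambda>z. \<eta>' z h)"
    and sym: "\<And>z h k. z \<in> S \<Longrightarrow> \<eta>' z h k = \<eta>' z k h"
  obtains Y where "\<And>z. z \<in> S \<Longrightarrow> (Y has_derivative \<eta> z) (at z)"
proof -
  define F where "F x t = \<eta> (t *\<^sub>R x) x" for x and t :: real
  define DF where "DF x t = \<eta> (t *\<^sub>R x) + t *\<^sub>R \<eta>' (t *\<^sub>R x) x" for x and t :: real
  have ray: "t *\<^sub>R x \<in> S" if "x \<in> S" "t \<in> cbox 0 1" for x and t :: real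
    using convexD_alt[OF assms(2,3) that(1), of t] that(2) by simp
  have lin: "linear (\<eta>' z)" if "z \<in> S" for z
    using d[OF that] by (rule has_derivative_linear)
  have cont: "continuous_on S \<eta>"
    by (rule has_derivative_continuous_on) (use d has_derivative_at_withinI in blast)
  have 1: "(F' has_derivative blinfun_apply (DF x t)) (at x within S)"
    if "x \<in> S" "t \<in> cbox 0 1" "F' = (\<lambda>x. F x t)" for x t F'
  proof -
    note z = ray[OF that(1,2)]
    have "((\<lambda>x. \<eta> (t *\<^sub>R x)) has_derivative (\<lambda>h. \<eta>' (t *\<^sub>R x) (t *\<^sub>R h))) (at x)"
      by (rule has_derivative_compose[where f = "\<lambda>x. t *\<^sub>R x" and g = \<eta>, OF _ d[OF z]]) (intro derivative_intros)
    then have "((\<lambda>x. F x t) has_derivative (\<lambda>h. \<eta> (t *\<^sub>R x) h + \<eta>' (t *\<^sub>R x) (t *\<^sub>R h) x)) (at x)"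
      unfolding F_def by (rule bounded_bilinear.FDERIV[OF bounded_bilinear_blinfun_apply _ has_derivative_ident])
    moreover have "\<eta> (t *\<^sub>R x) h + \<eta>' (t *\<^sub>R x) (t *\<^sub>R h) x = DF x t h" for h
      by (simp add: DF_def linear_scale[OF lin[OF z]] blinfun.bilinear_simps sym[OF z, of h x])
    ultimately show ?thesis by (auto intro: has_derivative_at_withinI simp: that)
  qed
  have 2: "F x integrable_on cbox 0 1" if "x \<in> S" for x
    unfolding F_def
    by (intro integrable_continuous continuous_intros continuous_on_compose2[OF cont]) (use ray that in auto)
  have 3: "continuous_on (S \<times> cbox 0 1) (\<lambda>(x, t). DF x t)"
  proof -
    let ?R = "S \<times> cbox 0 (1::real)"
    have p: "continuous_on ?R (\<lambda>y. snd y *\<^sub>R fst y)" "(\<lambda>y. snd y *\<^sub>R fst y) ` ?R \<subseteq> S"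
      using ray by (auto intro!: continuous_intros)
    have "continuous_on ?R (\<lambda>y. \<eta> (snd y *\<^sub>R fst y))"
      by (rule continuous_on_compose2[OF cont p])
    moreover have "continuous_on ?R (\<lambda>y. \<eta>' (snd y *\<^sub>R fst y) (fst y))"
      by (rule continuous_on_linear_family[of S \<eta>', OF lin c p continuous_on_fst[OF continuous_on_id]])
    ultimately show ?thesis
      unfolding DF_def case_prod_unfold
      by (intro continuous_on_add continuous_on_scaleR continuous_on_snd continuous_on_id)
  qed
  have 4: "integral (cbox 0 1) (DF x) = \<eta> x" if "x \<in> S" for x
  proof -
    have "((\<lambda>t. t *\<^sub>R \<eta> (t *\<^sub>R x)) has_vector_derivative DF x t) (at t within {0..1})" if t: "t \<in> {0..1}" for t
    proof -
      note z = ray[OF \<open>x \<in> S\<close>, of t]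
      have "((\<lambda>t. \<eta> (t *\<^sub>R x)) has_derivative (\<lambda>h. \<eta>' (t *\<^sub>R x) (h *\<^sub>R x))) (at t within {0..1})"
        by (rule has_derivative_compose[where f = "\<lambda>t. t *\<^sub>R x" and g = \<eta>, OF _ d]) (use z t in \<open>auto intro!: derivative_intros\<close>)
      then have "((\<lambda>t. \<eta> (t *\<^sub>R x)) has_vector_derivative \<eta>' (t *\<^sub>R x) x) (at t within {0..1})"
        using z t by (simp add: has_vector_derivative_def linear_scale[OF lin])
      from has_vector_derivative_scaleR[OF _ this, of "\<lambda>t. t" 1] show ?thesis
        by (simp add: DF_def add.commute DERIV_ident)
    qed
    then have "(DF x has_integral (1 *\<^sub>R \<eta> (1 *\<^sub>R x) - 0 *\<^sub>R \<eta> (0 *\<^sub>R x))) {0..1}"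
      by (intro fundamental_theorem_of_calculus) auto
    then show ?thesis by (simp add: integral_unique)
  qed
  have "((\<lambda>x. integral (cbox 0 1) (F x)) has_derivative \<eta> z) (at z)" if "z \<in> S" for z
    using leibniz_rule[of S 0 1 F DF z] 1 2 3 4 assms(2) that at_within_open[OF that assms(1)] by simp
  then show thesis by (rule that)
qed

text \<open>By the Riemann mapping theorem a nonempty \<open>V\<close> is the plane or the image of the unit disc under a biholomorphic
  map \<open>g\<close>. The pull-back of the form by \<open>g\<close> is closed on a convex set, where a primitive exists, and
  this primitive is transported back by the inverse \<open>f\<close> of \<open>g\<close>. The pull-back stays closed because
  its derivative in direction \<open>h\<close>, applied to \<open>k\<close>, is \<open>\<eta>(g'' h k) + \<eta>'(g' h)(g' k)\<close>.\<close>

lemma simply_connected_primitive: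
  fixes \<eta> :: "complex \<Rightarrow> complex \<Rightarrow>\<^sub>L 'b::banach"
  assumes "open V" "simply_connected V"
    and d: "\<And>z. z \<in> V \<Longrightarrow> (\<eta> has_derivative \<eta>' z) (at z)"
    and c: "\<And>h. continuous_on V (\<lambda>z. \<eta>' z h)"
    and sym: "\<And>z h k. z \<in> V \<Longrightarrow> \<eta>' z h k = \<eta>' z k h"
  obtains X where "\<And>z. z \<in> V \<Longrightarrow> (X has_derivative \<eta> z) (at z)"
proof -
  consider "V = {}" | "V = UNIV" | f g where
    "f holomorphic_on V" "g holomorphic_on ball 0 1"
    "\<And>z. z \<in> V \<Longrightarrow> f z \<in> ball 0 1 \<and> g (f z) = z"
    "\<And>z. z \<in> ball 0 1 \<Longrightarrow> g z \<in> V \<and> f (g z) = z"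
    using simply_connected_eq_biholomorphic_to_disc[OF assms(1)] assms(2) by auto
  then show thesis
  proof cases
    case 1
    then show thesis using that by auto
  next
    case 2
    then show thesis using poincare_convex[of V \<eta> \<eta>'] that assms by auto
  next
    case 3
    let ?D = "ball (0::complex) 1"
    define \<zeta> where "\<zeta> w = \<eta> (g w) o\<^sub>L blinfun_mult_right (deriv g w)" for w
    define \<zeta>' where "\<zeta>' w h = (\<eta> (g w) o\<^sub>L blinfun_mult_right (deriv (deriv g) w * h))
      + (\<eta>' (g w) (deriv g w * h) o\<^sub>L blinfun_mult_right (deriv g w))" for w h
    have g': "deriv g holomorphic_on ?D" and g'': "deriv (deriv g) holomorphic_on ?D"
      using 3(2) by (auto intro: holomorphic_deriv)
    have lin: "linear (\<eta>' z)" if "z \<in> V" for z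
      using d[OF that] by (rule has_derivative_linear)
    have cont: "continuous_on V \<eta>"
      by (rule has_derivative_continuous_on) (use d has_derivative_at_withinI in blast)
    have dg: "(g has_derivative (*) (deriv g w)) (at w)"
      and dg': "(deriv g has_derivative (*) (deriv (deriv g) w)) (at w)" if "w \<in> ?D" for w
      using holomorphic_derivI[OF 3(2) _ that] holomorphic_derivI[OF g' _ that]
      by (auto simp: has_field_derivative_def)
    have p1: "(\<zeta> has_derivative \<zeta>' w) (at w)" if w: "w \<in> ?D" for w
      unfolding \<zeta>_def \<zeta>'_def
      by (rule bounded_bilinear.FDERIV[OF bounded_bilinear_blinfun_compose
            has_derivative_compose[where g = \<eta>, OF dg[OF w] d]
            bounded_linear.has_derivative[OF bounded_linear_blinfun_mult_right dg'[OF w]]])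
        (use 3(4)[OF w] in simp)
    have p2: "continuous_on ?D (\<lambda>w. \<zeta>' w h)" for h
    proof -
      have gc: "continuous_on ?D g" "g ` ?D \<subseteq> V" "continuous_on ?D (deriv g)" "continuous_on ?D (deriv (deriv g))"
        using 3(2,4) g' g'' by (auto intro: holomorphic_on_imp_continuous_on)
      have "continuous_on ?D (\<lambda>w. \<eta> (g w))"
        by (rule continuous_on_compose2[OF cont gc(1,2)])
      moreover have "continuous_on ?D (\<lambda>w. \<eta>' (g w) (deriv g w * h))"
        by (rule continuous_on_linear_family[of V \<eta>', OF lin c gc(1,2) continuous_on_mult_right[OF gc(3)]])
      moreover have "continuous_on ?D (\<lambda>w. blinfun_mult_right (deriv (deriv g) w * h))"
        "continuous_on ?D (\<lambda>w. blinfun_mult_right (deriv g w))"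
        by (intro bounded_linear.continuous_on[OF bounded_linear_blinfun_mult_right]
            continuous_on_mult_right gc)+
      ultimately show ?thesis
        unfolding \<zeta>'_def
        by (intro continuous_on_add bounded_bilinear.continuous_on[OF bounded_bilinear_blinfun_compose])
    qed
    have p3: "\<zeta>' w h k = \<zeta>' w k h" if "w \<in> ?D" for w h k
      using sym[of "g w" "deriv g w * h" "deriv g w * k"] 3(4)[OF that]
      by (simp add: \<zeta>'_def blinfun.bilinear_simps mult.assoc mult.commute[of h k])
    obtain Y where Y: "\<And>w. w \<in> ?D \<Longrightarrow> (Y has_derivative \<zeta> w) (at w)"
      by (rule poincare_convex[of ?D \<zeta> \<zeta>', OF open_ball convex_ball])
        (simp, erule p1, rule p2, erule p3, blast)
    have "((\<lambda>z. Y (f z)) has_derivative \<eta> z) (at z)" if z: "z \<in> V" for z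
    proof -
      have df: "(f has_field_derivative deriv f z) (at z)"
        using holomorphic_derivI[OF 3(1) assms(1) z] .
      have "((\<lambda>w. g (f w)) has_field_derivative deriv g (f z) * deriv f z) (at z)"
        using DERIV_chain2[OF holomorphic_derivI[OF 3(2) _ ] df] 3(3)[OF z] by simp
      then have "((\<lambda>w. w) has_field_derivative deriv g (f z) * deriv f z) (at z)"
        by (rule has_field_derivative_transform_within_open[OF _ assms(1) z]) (use 3(3) in simp)
      then have 1: "deriv g (f z) * deriv f z = 1"
        using DERIV_ident DERIV_unique by blast
      have "((\<lambda>z. Y (f z)) has_derivative (\<lambda>h. \<zeta> (f z) (deriv f z * h))) (at z)"
        by (rule has_derivative_compose[where g = Y, OF has_field_derivative_imp_has_derivative[OF df] Y])
          (use 3(3)[OF z] in simp)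
      moreover have "\<zeta> (f z) (deriv f z * h) = \<eta> z h" for h
        using 3(3)[OF z] 1 by (simp add: \<zeta>_def mult.assoc[symmetric])
      ultimately show ?thesis by simp
    qed
    then show thesis by (rule that)
  qed
qed

lemma has_line_integral_primitive:
  assumes X: "\<And>z. z \<in> V \<Longrightarrow> (X has_derivative \<omega> z) (at z)" and "path_in V a b \<gamma>"
  shows "has_line_integral \<omega> \<gamma> (X b - X a)"
proof -
  have \<gamma>: "valid_path \<gamma>" "path_image \<gamma> \<subseteq> V" "\<gamma> 0 = a" "\<gamma> 1 = b"
    using assms(2) by (auto simp: path_in_def pathstart_def pathfinish_def)
  then obtain S where S: "finite S" "\<gamma> C1_differentiable_on {0..1} - S" and c: "continuous_on {0..1} \<gamma>"
    by (auto simp: valid_path_def piecewise_C1_differentiable_on_def)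
  have V: "\<gamma> t \<in> V" if "t \<in> {0..1}" for t
    using \<gamma>(2) that by (auto simp: path_image_def)
  have "((\<lambda>t. \<omega> (\<gamma> t) (vector_derivative \<gamma> (at t within {0..1}))) has_integral (X (\<gamma> 1) - X (\<gamma> 0))) {0..1}"
  proof (rule fundamental_theorem_of_calculus_interior_strong[OF S(1)])
    fix t :: real assume t: "t \<in> {0<..<1} - S"
    then have "\<gamma> differentiable at t"
      using S(2) by (auto simp: C1_differentiable_on_eq)
    then have 1: "(\<gamma> has_vector_derivative vector_derivative \<gamma> (at t)) (at t)"
      by (simp add: vector_derivative_works)
    have 2: "vector_derivative \<gamma> (at t within {0..1}) = vector_derivative \<gamma> (at t)"
      using t 1 by (intro vector_derivative_at_within_ivl) auto
    have X': "(X has_derivative \<omega> (\<gamma> t)) (at (\<gamma> t))"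
      using X V t by auto
    have "((\<lambda>t. X (\<gamma> t)) has_derivative (\<lambda>h. \<omega> (\<gamma> t) (h *\<^sub>R vector_derivative \<gamma> (at t)))) (at t)"
      using has_derivative_compose[where f = \<gamma> and g = X, OF _ X'] 1 unfolding has_vector_derivative_def by blast
    then show "((\<lambda>t. X (\<gamma> t)) has_vector_derivative \<omega> (\<gamma> t) (vector_derivative \<gamma> (at t within {0..1}))) (at t)"
      by (simp add: has_vector_derivative_def 2 linear_scale[OF has_derivative_linear[OF X']])
  next
    have "continuous_on V X"
      by (rule has_derivative_continuous_on) (use X has_derivative_at_withinI in blast)
    then show "continuous_on {0..1} (\<lambda>t. X (\<gamma> t))"
      by (rule continuous_on_compose2[OF _ c]) (use V in auto)
  qed simp
  then show ?thesis by (simp add: has_line_integral_def \<gamma>)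
qed


section \<open>Matrix algebra and Wirtinger derivatives\<close>

lemma cscale_nth [simp]: "(c *\<^sub>c M) $ i $ j = c * M $ i $ j"
  by (simp add: cscale_def)

lemma hconj_nth [simp]: "(M\<^sup>\<dagger>) $ i $ j = cnj (M $ j $ i)"
  by (simp add: hconj_def)

lemma hconj_hconj [simp]: "(M\<^sup>\<dagger>)\<^sup>\<dagger> = M"
  by (simp add: vec_eq_iff)

lemma hconj_add: "(M + M')\<^sup>\<dagger> = M\<^sup>\<dagger> + M'\<^sup>\<dagger>"
  by (simp add: vec_eq_iff)

lemma hconj_mult: "(M ** M')\<^sup>\<dagger> = M'\<^sup>\<dagger> ** M\<^sup>\<dagger>"
  by (simp add: vec_eq_iff matrix_matrix_mult_def mult.commute)

lemma hconj_comm: "(comm M M')\<^sup>\<dagger> = comm (M'\<^sup>\<dagger>) (M\<^sup>\<dagger>)"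
  by (simp add: comm_def hconj_mult[symmetric] vec_eq_iff)

lemma bounded_linear_hconj: "bounded_linear (hconj :: 'n::finite cmat \<Rightarrow> 'n cmat)"
  unfolding linear_conv_bounded_linear[symmetric] by (rule linearI) (auto simp: vec_eq_iff)

lemma bounded_bilinear_mat_mult:
  "bounded_bilinear ((**) :: 'n::finite cmat \<Rightarrow> 'n cmat \<Rightarrow> 'n cmat)"
  unfolding bilinear_conv_bounded_bilinear[symmetric] bilinear_def
  by (intro conjI allI linearI)
    (simp_all add: vec_eq_iff matrix_matrix_mult_def algebra_simps sum.distrib scaleR_sum_right)

lemma bounded_bilinear_comm: "bounded_bilinear (comm :: 'n::finite cmat \<Rightarrow> 'n cmat \<Rightarrow> 'n cmat)"
  unfolding bilinear_conv_bounded_bilinear[symmetric] bilinear_def comm_def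
  by (intro conjI allI linearI)
    (simp_all add: vec_eq_iff matrix_matrix_mult_def algebra_simps sum.distrib scaleR_sum_right)

lemmas mat_mult_diff = bounded_bilinear.diff_left[OF bounded_bilinear_mat_mult]
  bounded_bilinear.diff_right[OF bounded_bilinear_mat_mult]

lemmas comm_add_left = bounded_bilinear.add_left[OF bounded_bilinear_comm]
lemmas comm_diff_right = bounded_bilinear.diff_right[OF bounded_bilinear_comm]
lemmas comm_minus_left = bounded_bilinear.minus_left[OF bounded_bilinear_comm]

lemma comm_flip: "comm M M' = - comm M' M"
  by (simp add: comm_def)

lemma comm_cscale_left: "comm (c *\<^sub>c M) M' = c *\<^sub>c comm M M'"
  by (simp add: comm_def vec_eq_iff matrix_matrix_mult_def algebra_simps sum_distrib_left)

lemma comm_cscale_right: "comm M (c *\<^sub>c M') = c *\<^sub>c comm M M'"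
  by (simp add: comm_def vec_eq_iff matrix_matrix_mult_def algebra_simps sum_distrib_left)

lemma comm_jacobi: "comm (comm S A) B - comm (comm S B) A = comm S (comm A B)"
  by (simp add: comm_def mat_mult_diff matrix_mul_assoc)

lemma trace_comm: "trace (comm M M') = 0"
  by (simp add: comm_def trace_sub trace_mul_sym[of M M'])

lemma mat_wirtinger:
  assumes "(F has_derivative D) (at z)"
  shows mat_dz_eq: "mat_dz F z = (1 / 2) *\<^sub>c (D 1 - \<i> *\<^sub>c D \<i>)"
    and mat_dzbar_eq: "mat_dzbar F z = (1 / 2) *\<^sub>c (D 1 + \<i> *\<^sub>c D \<i>)"
proof -
  have "((\<lambda>w. F w $ i $ j) has_derivative (\<lambda>h. D h $ i $ j)) (at z)" for i j
    by (intro bounded_linear.has_derivative[OF bounded_linear_vec_nth] assms)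
  then have "frechet_derivative (\<lambda>w. F w $ i $ j) (at z) = (\<lambda>h. D h $ i $ j)" for i j
    by (rule frechet_derivative_at[symmetric])
  then show "mat_dz F z = (1 / 2) *\<^sub>c (D 1 - \<i> *\<^sub>c D \<i>)" "mat_dzbar F z = (1 / 2) *\<^sub>c (D 1 + \<i> *\<^sub>c D \<i>)"
    by (simp_all add: mat_dz_def mat_dzbar_def dz_def dzbar_def vec_eq_iff)
qed

lemma derivative_wirtinger:
  assumes "(F has_derivative D) (at z)"
  shows "D v = v *\<^sub>c mat_dz F z + cnj v *\<^sub>c mat_dzbar F z"
proof -
  have l: "linear D" using assms by (rule has_derivative_linear)
  have "D v = D (Re v *\<^sub>R 1 + Im v *\<^sub>R \<i>)"
    by (rule arg_cong[where f = D]) (simp add: complex_eq_iff)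
  also have "\<dots> = Re v *\<^sub>R D 1 + Im v *\<^sub>R D \<i>"
    by (simp add: linear_add[OF l] linear_scale[OF l])
  finally show ?thesis
    by (simp add: mat_dz_eq[OF assms] mat_dzbar_eq[OF assms] vec_eq_iff complex_eq_iff algebra_simps)
      (simp add: field_simps)
qed

lemma mat_wirtinger_comm:
  assumes F: "(F has_derivative DF) (at z)" and G: "(G has_derivative DG) (at z)"
  shows "mat_dz (\<lambda>w. comm (F w) (G w)) z = comm (F z) (mat_dz G z) + comm (mat_dz F z) (G z)"
    and "mat_dzbar (\<lambda>w. comm (F w) (G w)) z = comm (F z) (mat_dzbar G z) + comm (mat_dzbar F z) (G z)"
proof -
  note d = bounded_bilinear.FDERIV[OF bounded_bilinear_comm F G]
  note c = comm_cscale_left comm_cscale_right bounded_bilinear.add_left[OF bounded_bilinear_comm]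
    bounded_bilinear.add_right[OF bounded_bilinear_comm] bounded_bilinear.diff_left[OF bounded_bilinear_comm]
    bounded_bilinear.diff_right[OF bounded_bilinear_comm]
  show "mat_dz (\<lambda>w. comm (F w) (G w)) z = comm (F z) (mat_dz G z) + comm (mat_dz F z) (G z)"
    by (simp add: mat_dz_eq[OF d] mat_dz_eq[OF F] mat_dz_eq[OF G] c) (simp add: vec_eq_iff algebra_simps)
  show "mat_dzbar (\<lambda>w. comm (F w) (G w)) z = comm (F z) (mat_dzbar G z) + comm (mat_dzbar F z) (G z)"
    by (simp add: mat_dzbar_eq[OF d] mat_dzbar_eq[OF F] mat_dzbar_eq[OF G] c) (simp add: vec_eq_iff algebra_simps)
qed

lemma mat_wirtinger_hconj:
  assumes F: "(F has_derivative DF) (at z)"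
  shows "mat_dz (\<lambda>w. (F w)\<^sup>\<dagger>) z = (mat_dzbar F z)\<^sup>\<dagger>"
    and "mat_dzbar (\<lambda>w. (F w)\<^sup>\<dagger>) z = (mat_dz F z)\<^sup>\<dagger>"
proof -
  note d = bounded_linear.has_derivative[OF bounded_linear_hconj F]
  show "mat_dz (\<lambda>w. (F w)\<^sup>\<dagger>) z = (mat_dzbar F z)\<^sup>\<dagger>"
    unfolding mat_dz_eq[OF d] mat_dzbar_eq[OF F] by (simp add: vec_eq_iff)
  show "mat_dzbar (\<lambda>w. (F w)\<^sup>\<dagger>) z = (mat_dz F z)\<^sup>\<dagger>"
    unfolding mat_dzbar_eq[OF d] mat_dz_eq[OF F] by (simp add: vec_eq_iff)
qed

lemma mat_wirtinger_add:
  assumes F: "(F has_derivative DF) (at z)" and G: "(G has_derivative DG) (at z)"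
  shows "mat_dz (\<lambda>w. F w + G w) z = mat_dz F z + mat_dz G z"
    and "mat_dzbar (\<lambda>w. F w + G w) z = mat_dzbar F z + mat_dzbar G z"
proof -
  note d = has_derivative_add[OF F G]
  show "mat_dz (\<lambda>w. F w + G w) z = mat_dz F z + mat_dz G z"
    unfolding mat_dz_eq[OF d] mat_dz_eq[OF F] mat_dz_eq[OF G] by (simp add: vec_eq_iff field_simps)
  show "mat_dzbar (\<lambda>w. F w + G w) z = mat_dzbar F z + mat_dzbar G z"
    unfolding mat_dzbar_eq[OF d] mat_dzbar_eq[OF F] mat_dzbar_eq[OF G] by (simp add: vec_eq_iff field_simps)
qed


section \<open>The conservation law\<close>

text \<open>Put \<open>S = L + L\<^sup>\<dagger>\<close>. Taking adjoints in the two Lax equations for \<open>L\<close> and using \<open>B = - A\<^sup>\<dagger>\<close> shows that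
  \<open>L\<^sup>\<dagger>\<close>, and hence \<open>S\<close>, satisfies the same two equations. The difference of the two sides is then
  \<open>[[S, A], B] - [[S, B], A] - [S, mat_dzbar A - mat_dz B]\<close>, which vanishes by the zero curvature equation and the
  Jacobi identity.\<close>

lemma conservation_law:
  fixes L A B :: "complex \<Rightarrow> 'n::finite cmat"
  defines "S \<equiv> \<lambda>w. L w + (L w)\<^sup>\<dagger>"
  assumes B: "\<And>w. B w = - (A w)\<^sup>\<dagger>"
    and L: "(L has_derivative DL) (at z)" and A: "(A has_derivative DA) (at z)"
    and dL: "mat_dz L z = comm (L z) (A z)" "mat_dzbar L z = comm (L z) (B z)"
    and zc: "mat_dzbar A z - mat_dz B z = comm (A z) (B z)"
  shows "mat_dz (\<lambda>w. comm (S w) (B w)) z = mat_dzbar (\<lambda>w. comm (S w) (A w)) z"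
proof -
  have A_B: "(B z)\<^sup>\<dagger> = - A z" "(A z)\<^sup>\<dagger> = - B z"
    by (simp_all add: B vec_eq_iff)
  have Bd: "(B has_derivative (\<lambda>h. - (DA h)\<^sup>\<dagger>)) (at z)"
    unfolding B[abs_def] by (intro has_derivative_minus bounded_linear.has_derivative[OF bounded_linear_hconj] A)
  note Ld = bounded_linear.has_derivative[OF bounded_linear_hconj L]
  have Sd: "(S has_derivative (\<lambda>h. DL h + (DL h)\<^sup>\<dagger>)) (at z)"
    unfolding S_def by (rule has_derivative_add[OF L Ld])
  have "mat_dz S z = comm (L z) (A z) + (comm (L z) (B z))\<^sup>\<dagger>"
    unfolding S_def by (simp add: mat_wirtinger_add[OF L Ld] mat_wirtinger_hconj[OF L] dL)
  also have "\<dots> = comm (S z) (A z)"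
    by (simp add: hconj_comm A_B comm_minus_left S_def comm_add_left comm_flip[of "A z"])
  finally have 1: "mat_dz S z = comm (S z) (A z)" .
  have "mat_dzbar S z = comm (L z) (B z) + (comm (L z) (A z))\<^sup>\<dagger>"
    unfolding S_def by (simp add: mat_wirtinger_add[OF L Ld] mat_wirtinger_hconj[OF L] dL)
  also have "\<dots> = comm (S z) (B z)"
    by (simp add: hconj_comm A_B comm_minus_left S_def comm_add_left comm_flip[of "B z"])
  finally have 2: "mat_dzbar S z = comm (S z) (B z)" .
  have "mat_dz (\<lambda>w. comm (S w) (B w)) z - mat_dzbar (\<lambda>w. comm (S w) (A w)) z
      = comm (comm (S z) (A z)) (B z) - comm (comm (S z) (B z)) (A z)
        - comm (S z) (mat_dzbar A z - mat_dz B z)"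
    by (simp add: mat_wirtinger_comm[OF Sd Bd] mat_wirtinger_comm[OF Sd A] 1 2 comm_diff_right)
  also have "\<dots> = 0"
    by (simp add: zc comm_jacobi)
  finally show ?thesis by simp
qed


section \<open>The matrix-valued 1-form\<close>

text \<open>The 1-form of the theorem depends on the point only through \<open>K\<close>, and real-linearly. Separating this
  dependence lets the calculus of linear maps act on \<open>K\<close> alone.\<close>

definition su_form :: "'n::finite cmat \<Rightarrow> complex \<Rightarrow> 'n cmat" where
  "su_form M v = \<i> *\<^sub>c (v *\<^sub>c M\<^sup>\<dagger> + cnj v *\<^sub>c M)"

lemma bounded_linear_su_form: "bounded_linear (su_form M)"
  unfolding linear_conv_bounded_linear[symmetric]
  by (rule linearI) (auto simp: su_form_def vec_eq_iff algebra_simps scaleR_conv_of_real[where 'a = complex])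

lemma bounded_linear_su_form_left: "bounded_linear (\<lambda>M :: 'n::finite cmat. su_form M v)"
  unfolding linear_conv_bounded_linear[symmetric]
  by (rule linearI) (auto simp: su_form_def vec_eq_iff algebra_simps scaleR_conv_of_real[where 'a = complex])

lemma su_form_apply: "blinfun_apply (Blinfun (su_form M)) = su_form M"
  by (rule bounded_linear_Blinfun_apply[OF bounded_linear_su_form])

text \<open>Real-linearity in \<open>M\<close> makes the operator-valued form as smooth as \<open>K\<close>, as the Poincare lemma
  requires.\<close>

lemma bounded_linear_Blinfun_su_form:
  "bounded_linear (\<lambda>M :: 'n::finite cmat. Blinfun (su_form M))"
  unfolding linear_conv_bounded_linear[symmetric]
  by (rule linearI; rule blinfun_eqI)
    (simp_all add: su_form_apply blinfun.bilinear_simps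
      linear_add[OF bounded_linear.linear[OF bounded_linear_su_form_left]]
      linear_scale[OF bounded_linear.linear[OF bounded_linear_su_form_left]])

lemma su_form_in_su:
  assumes "trace M = 0" shows "su_form M v \<in> su"
proof -
  have t: "(\<Sum>i\<in>UNIV. M $ i $ i) = 0" "(\<Sum>i\<in>UNIV. cnj (M $ i $ i)) = 0"
    using assms by (simp_all add: trace_def cnj_sum[symmetric])
  have "trace (su_form M v) = \<i> * (v * (\<Sum>i\<in>UNIV. cnj (M $ i $ i)) + cnj v * (\<Sum>i\<in>UNIV. M $ i $ i))"
    by (simp add: trace_def su_form_def sum_distrib_left sum.distrib algebra_simps)
  moreover have "(su_form M v)\<^sup>\<dagger> = - su_form M v"
    by (simp add: su_form_def vec_eq_iff algebra_simps)
  ultimately show ?thesis by (simp add: su_def t)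
qed

lemma su_form_wirtinger:
  assumes "(X has_derivative su_form M) (at z)"
  shows "mat_dz X z = \<i> *\<^sub>c M\<^sup>\<dagger>" and "mat_dzbar X z = \<i> *\<^sub>c M"
  unfolding mat_dz_eq[OF assms] mat_dzbar_eq[OF assms]
  by (simp_all add: su_form_def vec_eq_iff algebra_simps)

text \<open>By the conservation law \<open>P = mat_dz K\<close> equals the adjoint of itself. With \<open>Q = mat_dzbar K\<close> the
  derivative of \<open>K\<close> in direction \<open>v\<close> is \<open>v P + cnj v Q\<close>, and inserting it gives
  \<open>\<i> (w cnj v P + cnj w v P + w v Q\<^sup>\<dagger> + cnj w cnj v Q)\<close>, an expression symmetric in \<open>v\<close> and \<open>w\<close>.\<close>

lemma su_form_closed:
  assumes K: "(K has_derivative DK) (at z)" and "mat_dz K z = mat_dzbar (\<lambda>w. (K w)\<^sup>\<dagger>) z"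
  shows "su_form (DK v) w = su_form (DK w) v"
proof -
  have "mat_dz K z = (mat_dz K z)\<^sup>\<dagger>"
    using assms(2) by (simp add: mat_wirtinger_hconj[OF K])
  then have P: "cnj (mat_dz K z $ i $ j) = mat_dz K z $ j $ i" for i j
    by (metis hconj_nth)
  show ?thesis
    unfolding derivative_wirtinger[OF K, of v] derivative_wirtinger[OF K, of w]
    by (simp add: su_form_def vec_eq_iff P algebra_simps)
qed


section \<open>The Lie algebra\<close>

lemma subspace_su: "subspace (su :: ('n::finite cmat) set)"
  unfolding subspace_def su_def
  by (auto simp: vec_eq_iff trace_def sum.distrib scaleR_sum_right[symmetric])

text \<open>A real matrix \<open>R\<close> is sent to \<open>(R - R\<^sup>T) + \<i> (R + R\<^sup>T)\<close>. This is an isomorphism onto the anti-Hermitian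
  matrices that turns the trace into a multiple of the inner product with the identity, so \<open>su\<close> is
  the image of a hyperplane.\<close>

lemma dim_su: "dim (su :: ('n::finite cmat) set) = CARD('n)\<^sup>2 - 1"
proof -
  define f :: "real^'n^'n \<Rightarrow> 'n cmat"
    where "f R = (\<chi> i j. Complex (R $ i $ j - R $ j $ i) (R $ i $ j + R $ j $ i))" for R
  define H where "H = {R :: real^'n^'n. mat 1 \<bullet> R = 0}"
  have lin: "linear f"
    by (rule linearI) (auto simp: f_def vec_eq_iff complex_eq_iff algebra_simps)
  have R: "R $ i $ j = (Re (f R $ i $ j) + Im (f R $ i $ j)) / 2" for R i j
    by (simp add: f_def)
  have inj: "inj f"
    by (rule injI) (metis R vec_eq_iff)
  have mat1: "mat 1 \<bullet> R = (\<Sum>i\<in>UNIV. R $ i $ i)" for R :: "real^'n^'n"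
    by (simp add: inner_vec_def mat_def if_distrib[of "\<lambda>x. x * _"] cong: if_cong)
  have tr: "trace (f R) = Complex 0 (2 * (mat 1 \<bullet> R))" for R
    by (simp add: mat1 trace_def f_def complex_eq_iff sum_distrib_left)
  have "f ` H = su"
  proof
    show "f ` H \<subseteq> su"
      by (auto simp: su_def H_def tr complex_eq_iff) (auto simp: f_def vec_eq_iff complex_eq_iff)
    show "su \<subseteq> f ` H"
    proof
      fix M :: "'n cmat" assume M: "M \<in> su"
      define R :: "real^'n^'n" where "R = (\<chi> i j. (Re (M $ i $ j) + Im (M $ i $ j)) / 2)"
      have cnj_M: "cnj (M $ j $ i) = - M $ i $ j" for i j
        using M by (auto simp: su_def vec_eq_iff)
      have re: "Re (M $ j $ i) = - Re (M $ i $ j)" and im: "Im (M $ j $ i) = Im (M $ i $ j)" for i j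
        using arg_cong[OF cnj_M[of j i], of Re] arg_cong[OF cnj_M[of j i], of Im] by simp_all
      have "f R $ i $ j = M $ i $ j" for i j
        by (simp add: f_def R_def complex_eq_iff re[of j i] im[of j i] field_simps)
      then have "f R = M"
        by (simp add: vec_eq_iff)
      moreover have "R \<in> H"
        using tr[of R] M by (simp add: \<open>f R = M\<close> H_def su_def complex_eq_iff)
      ultimately show "M \<in> f ` H" by blast
    qed
  qed
  moreover have "dim (f ` H) = dim H"
    using lin inj by (intro dim_image_eq) (auto intro: inj_on_subset)
  moreover have "dim H = DIM(real^'n^'n) - 1"
    unfolding H_def by (rule dim_hyperplane) (simp add: vec_eq_iff mat_def)
  ultimately show ?thesis by (simp add: power2_eq_square)
qed


section \<open>The surface\<close>

lemma primitive_stays_in_kernel: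
  assumes "open V" "connected V" "bounded_linear h"
    and X: "\<And>z. z \<in> V \<Longrightarrow> (X has_derivative D z) (at z)" and h: "\<And>z v. z \<in> V \<Longrightarrow> h (D z v) = 0"
    and a: "a \<in> V" "h (X a) = 0" and "z \<in> V"
  shows "h (X z) = 0"
proof -
  have "((\<lambda>z. h (X z)) has_derivative (\<lambda>v. 0)) (at z)" if "z \<in> V" for z
    using bounded_linear.has_derivative[OF assms(3) X[OF that]] h[OF that] by simp
  from has_derivative_zero_unique_connected[OF assms(1,2) this \<open>z \<in> V\<close> a(1)] show ?thesis
    using a(2) by simp
qed

lemma bounded_linear_trace: "bounded_linear (trace :: 'n::finite cmat \<Rightarrow> complex)"
  unfolding linear_conv_bounded_linear[symmetric]
  by (rule linearI) (auto simp: trace_def sum.distrib scaleR_sum_right)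

text \<open>The space \<open>su\<close> is the common kernel of \<open>trace\<close> and \<open>M \<mapsto> M\<^sup>\<dagger> + M\<close>, and a primitive that starts in a
  kernel to which its derivative is confined cannot leave it.\<close>

lemma primitive_in_su:
  assumes "open V" "connected V"
    and X: "\<And>z. z \<in> V \<Longrightarrow> (X has_derivative D z) (at z)" and D: "\<And>z v. z \<in> V \<Longrightarrow> D z v \<in> su"
    and a: "a \<in> V" "X a = 0" and "z \<in> V"
  shows "X z \<in> su"
proof -
  have "trace (X z) = 0"
    using primitive_stays_in_kernel[OF assms(1,2) bounded_linear_trace X _ a(1) _ \<open>z \<in> V\<close>] D a(2)
    by (simp add: su_def trace_def)
  moreover have "(X z)\<^sup>\<dagger> + X z = 0"
    using primitive_stays_in_kernel[OF assms(1,2) bounded_linear_add[OF bounded_linear_hconj bounded_linear_ident]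
        X _ a(1) _ \<open>z \<in> V\<close>] D a(2)
    by (simp add: su_def vec_eq_iff)
  ultimately show ?thesis by (simp add: su_def add_eq_0_iff2)
qed

theorem mainTheorem2:
  fixes \<Omega> :: "complex set"
    and N m :: nat
    and u :: "'n::{finite,linorder} \<Rightarrow> complex \<Rightarrow> real"
    and T :: "complex \<Rightarrow> 'n lser"
    and lam :: complex
    and A B L K :: "complex \<Rightarrow> 'n cmat"
    and \<omega> :: "complex \<Rightarrow> complex \<Rightarrow> 'n cmat"
  defines "A \<equiv> toda_A lam u"
    and "B \<equiv> toda_B lam u"
    and "L \<equiv> flow_L lam m T"
    and "K \<equiv> (\<lambda>z. comm (L z + (L z)\<^sup>\<dagger>) (B z))"
    and "\<omega> \<equiv> (\<lambda>z v. \<i> *\<^sub>c (v *\<^sub>c (K z)\<^sup>\<dagger> + cnj v *\<^sub>c K z))"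
  assumes "CARD('n) = N + 1" and "N \<ge> 1"
    and "open \<Omega>" and "connected \<Omega>" and "\<Omega> \<noteq> {}"
    and "\<And>i. smooth_on \<Omega> (u i)"
    and "\<And>z. z \<in> \<Omega> \<Longrightarrow> (\<Sum>i\<in>UNIV. u i z) = 0"
    and "toda_lattice \<Omega> u"
    and "norm lam = 1"
    and "m \<ge> 1"
    and "dressing \<Omega> u T"
    and "flow_trivial \<Omega> lam m u T"
  shows "(\<forall>z\<in>\<Omega>. mat_dz L z = comm (L z) (A z) \<and> mat_dzbar L z = comm (L z) (B z))
    \<and> (\<forall>z\<in>\<Omega>. (K z)\<^sup>\<dagger> = comm (L z + (L z)\<^sup>\<dagger>) (A z))
    \<and> (\<forall>z\<in>\<Omega>. mat_dz K z - mat_dzbar (\<lambda>w. (K w)\<^sup>\<dagger>) z = 0)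
    \<and> closed_form \<Omega> \<omega>
    \<and> (\<forall>z\<in>\<Omega>. \<forall>v. \<omega> z v \<in> su)
    \<and> (\<forall>V. open V \<and> simply_connected V \<and> V \<subseteq> \<Omega> \<longrightarrow>
         (\<forall>a b \<gamma>\<^sub>1 \<gamma>\<^sub>2. path_in V a b \<gamma>\<^sub>1 \<and> path_in V a b \<gamma>\<^sub>2 \<longrightarrow>
            (\<exists>I. has_line_integral \<omega> \<gamma>\<^sub>1 I \<and> has_line_integral \<omega> \<gamma>\<^sub>2 I)))
    \<and> subspace (su :: ('n cmat) set)
    \<and> dim (su :: ('n cmat) set) = (N + 1)\<^sup>2 - 1
    \<and> (\<forall>V \<xi>\<^sub>0. open V \<and> simply_connected V \<and> V \<subseteq> \<Omega> \<and> \<xi>\<^sub>0 \<in> V \<longrightarrow>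
         (\<exists>X. (\<forall>z\<in>V. \<forall>\<gamma>. path_in V \<xi>\<^sub>0 z \<gamma> \<longrightarrow> has_line_integral \<omega> \<gamma> (X z))
            \<and> smooth_on V X
            \<and> (\<forall>z\<in>V. X z \<in> su
                  \<and> mat_dz X z = \<i> *\<^sub>c (K z)\<^sup>\<dagger>
                  \<and> mat_dzbar X z = \<i> *\<^sub>c K z)))"
proof -
  note card = assms(6,7) and op = assms(8)
  have CARD: "CARD('n) \<ge> 2" using card by simp
  have B: "B w = - (A w)\<^sup>\<dagger>" for w
    unfolding A_def B_def by (rule toda_B_unitary[OF CARD assms(14)])
  have sL: "smooth_on \<Omega> L"
    unfolding L_def by (rule smooth_flow_L[OF op assms(16)])
  have sA: "smooth_on \<Omega> A"
    unfolding A_def by (rule smooth_toda_A[OF op assms(11)])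
  have sB: "smooth_on \<Omega> B"
    unfolding B[abs_def] by (intro smooth_on_minus smooth_on_linear[OF bounded_linear_hconj] op sA)
  have sK: "smooth_on \<Omega> K"
    unfolding K_def
    by (intro smooth_on_bilinear[OF bounded_bilinear_comm] smooth_on_add smooth_on_linear[OF bounded_linear_hconj] op sL sB)
  have lax: "mat_dz L z = comm (L z) (A z)" "mat_dzbar L z = comm (L z) (B z)" if "z \<in> \<Omega>" for z
    using assms(17) that comm_flip[of "A z" "L z"] comm_flip[of "B z" "L z"]
    by (auto simp: flow_trivial_def flow_eqs_def A_def B_def L_def)
  have K_adj: "(K z)\<^sup>\<dagger> = comm (L z + (L z)\<^sup>\<dagger>) (A z)" for z
  proof -
    have "(B z)\<^sup>\<dagger> = - A z" by (simp add: B vec_eq_iff)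
    then show ?thesis
      by (simp add: K_def hconj_comm hconj_add comm_minus_left comm_flip[of "A z"] add.commute)
  qed
  have zc: "mat_dzbar A z - mat_dz B z = comm (A z) (B z)" if "z \<in> \<Omega>" for z
  proof -
    have "lam \<noteq> 0" using assms(14) by auto
    then show ?thesis using assms(13) that by (simp add: toda_lattice_def A_def B_def)
  qed
  have law: "mat_dz K z = mat_dzbar (\<lambda>w. (K w)\<^sup>\<dagger>) z" if z: "z \<in> \<Omega>" for z
    using conservation_law[OF B smooth_on_has_derivative[OF sL z] smooth_on_has_derivative[OF sA z] lax[OF z] zc[OF z]]
    unfolding K_adj by (simp add: K_def)
  have \<omega>: "\<omega> z = su_form (K z)" for z
    by (simp add: \<omega>_def su_form_def fun_eq_iff)
  have in_su: "\<omega> z v \<in> su" for z v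
    unfolding \<omega> by (rule su_form_in_su) (simp add: K_def trace_comm)
  define DK where "DK z = frechet_derivative K (at z)" for z
  have dK: "(K has_derivative DK z) (at z)" if "z \<in> \<Omega>" for z
    unfolding DK_def by (rule smooth_on_has_derivative[OF sK that])
  have sw: "smooth_on \<Omega> (\<lambda>z. \<omega> z v)" for v
    unfolding \<omega> by (rule smooth_on_linear[OF bounded_linear_su_form_left op sK])
  have d\<omega>: "frechet_derivative (\<lambda>\<zeta>. \<omega> \<zeta> w) (at z) = (\<lambda>v. su_form (DK z v) w)" if "z \<in> \<Omega>" for z w
    unfolding \<omega>
    by (rule frechet_derivative_at[symmetric])
      (rule bounded_linear.has_derivative[OF bounded_linear_su_form_left dK[OF that]])
  have sym: "su_form (DK z v) w = su_form (DK z w) v" if "z \<in> \<Omega>" for z v w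
    by (rule su_form_closed[OF dK[OF that] law[OF that]])
  have closed: "closed_form \<Omega> \<omega>"
    unfolding closed_form_def using sw d\<omega> sym by simp
  have primitive: "\<exists>X. \<forall>z\<in>V. (X has_derivative \<omega> z) (at z)"
    if V: "open V" "simply_connected V" "V \<subseteq> \<Omega>" for V
  proof -
    define \<eta> where "\<eta> z = Blinfun (su_form (K z))" for z
    define \<eta>' where "\<eta>' z h = Blinfun (su_form (DK z h))" for z h
    have 1: "(\<eta> has_derivative \<eta>' z) (at z)" if "z \<in> V" for z
      unfolding \<eta>_def \<eta>'_def
      using bounded_linear.has_derivative[OF bounded_linear_Blinfun_su_form dK] that V(3) by auto
    have 2: "continuous_on V (\<lambda>z. \<eta>' z h)" for h
    proof -
      have "continuous_on \<Omega> (\<lambda>z. \<eta>' z h)"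
        unfolding \<eta>'_def DK_def
        by (intro smooth_on_continuous_on smooth_on_linear[OF bounded_linear_Blinfun_su_form op]
            smooth_on_derivative sK)
      then show ?thesis using V(3) by (rule continuous_on_subset)
    qed
    have 3: "\<eta>' z h k = \<eta>' z k h" if "z \<in> V" for z h k
      using sym[of z h k] that V(3) by (auto simp: \<eta>'_def su_form_apply)
    obtain X where "\<And>z. z \<in> V \<Longrightarrow> (X has_derivative \<eta> z) (at z)"
      by (rule simply_connected_primitive[of V \<eta> \<eta>', OF V(1,2)]) (erule 1, rule 2, erule 3, blast)
    then show ?thesis by (auto simp: \<eta>_def su_form_apply \<omega>)
  qed
  have path_indep: "\<exists>I. has_line_integral \<omega> \<gamma>\<^sub>1 I \<and> has_line_integral \<omega> \<gamma>\<^sub>2 I"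
    if V: "open V" "simply_connected V" "V \<subseteq> \<Omega>" and p: "path_in V a b \<gamma>\<^sub>1" "path_in V a b \<gamma>\<^sub>2" for V a b \<gamma>\<^sub>1 \<gamma>\<^sub>2
  proof -
    obtain X where X: "\<And>z. z \<in> V \<Longrightarrow> (X has_derivative \<omega> z) (at z)"
      using primitive[OF V] by blast
    show ?thesis
      using has_line_integral_primitive[OF X p(1)] has_line_integral_primitive[OF X p(2)] by blast
  qed
  have surface: "\<exists>X. (\<forall>z\<in>V. \<forall>\<gamma>. path_in V \<xi>\<^sub>0 z \<gamma> \<longrightarrow> has_line_integral \<omega> \<gamma> (X z))
            \<and> smooth_on V X
            \<and> (\<forall>z\<in>V. X z \<in> su
                  \<and> mat_dz X z = \<i> *\<^sub>c (K z)\<^sup>\<dagger>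
                  \<and> mat_dzbar X z = \<i> *\<^sub>c K z)"
    if V: "open V" "simply_connected V" "V \<subseteq> \<Omega>" "\<xi>\<^sub>0 \<in> V" for V \<xi>\<^sub>0
  proof -
    obtain X0 where X0: "\<And>z. z \<in> V \<Longrightarrow> (X0 has_derivative \<omega> z) (at z)"
      using primitive[OF V(1-3)] by blast
    define X where "X z = X0 z - X0 \<xi>\<^sub>0" for z
    have X: "(X has_derivative \<omega> z) (at z)" if "z \<in> V" for z
      unfolding X_def using has_derivative_diff[OF X0[OF that] has_derivative_const] by simp
    have "has_line_integral \<omega> \<gamma> (X z)" if "path_in V \<xi>\<^sub>0 z \<gamma>" for z \<gamma>
      unfolding X_def by (rule has_line_integral_primitive[OF X0 that])
    moreover have "smooth_on V X"
      by (rule smooth_on_primitive[OF V(1) X]) (auto intro: smooth_on_mono[OF sw V(3)])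
    moreover have "X z \<in> su" if "z \<in> V" for z
      by (rule primitive_in_su[OF V(1) simply_connected_imp_connected[OF V(2)] X in_su V(4) _ that])
        (auto simp: X_def)
    moreover have "mat_dz X z = \<i> *\<^sub>c (K z)\<^sup>\<dagger>" "mat_dzbar X z = \<i> *\<^sub>c K z" if "z \<in> V" for z
      using su_form_wirtinger[OF X[OF that, unfolded \<omega>]] .
    ultimately show ?thesis by blast
  qed
  show ?thesis
    using lax K_adj law closed in_su path_indep surface subspace_su dim_su[where 'n = 'n] card(1)
    by (intro conjI ballI allI impI) auto
qed

end
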